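(* Let $\{\alpha_n\}_{n=0}^\infty$ and $\{\beta_n\}_{n=0}^\infty$ be two sequences in the closed unit disk $\overline{\mathbb{D}}$, and let $\rho_n=(1-|\alpha_n|^2)^{1/2}$, $\sigma_n=(1-|\beta_n|^2)^{1/2}$. Then $$\big\|\mathcal{G}(\{\alpha_n\}_{n=0}^\infty)-\mathcal{G}(\{\beta_n\}_{n=0}^\infty)\big\|_1\le 2\sum_{n=0}^\infty\big(|\alpha_n-\beta_n|+|\sigma_n-\rho_n|\big),$$ where $\|\cdot\|_1$ is the trace norm on operators on $\ell^2(\{0,1,2,\dots\})$.
   Context: For a sequence $\{\alpha_n\}_{n=0}^\infty$ in $\overline{\mathbb{D}}=\{z\in\mathbb{C}:|z|\le1\}$, with $\rho_n=(1-|\alpha_n|^2)^{1/2}$ and the convention $\alpha_{-1}=-1$, the GGT matrix $\mathcal{G}(\{\alpha_n\}_{n=0}^\infty)$ is the operator on $\ell^2(\{0,1,2,\dots\})$ with matrix elements ($k,\ell\ge0$) $$\mathcal{G}_{k\ell}=\begin{cases}-\bar\alpha_\ell\,\alpha_{k-1}\prod_{m=k}^{\ell-1}\rho_m,&0\le k\le\ell,\\ \rho_\ell,&k=\ell+1,\\ 0,&k\ge\ell+2.\end{cases}$$ (The empty product is $1$.) If the right side of the inequality is infinite there is nothing to assert; otherwise the claim includes that the difference is trace class. *)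

theory Defs
  imports "HOL-Analysis.Analysis"
begin

section \<open>The Hilbert space of square-summable complex sequences\<close>

lemma square_summable_add:
  fixes x y :: "nat \<Rightarrow> complex"
  assumes "summable (\<lambda>n. (cmod (x n))\<^sup>2)" "summable (\<lambda>n. (cmod (y n))\<^sup>2)"
  shows "summable (\<lambda>n. (cmod (x n + y n))\<^sup>2)"
proof (rule summable_comparison_test')
  show "summable (\<lambda>n. 2 * (cmod (x n))\<^sup>2 + 2 * (cmod (y n))\<^sup>2)"
    using assms by (intro summable_add summable_mult)
  fix n :: nat
  have "(cmod (x n + y n))\<^sup>2 \<le> (cmod (x n) + cmod (y n))\<^sup>2"
    by (intro power_mono norm_triangle_ineq norm_ge_zero)
  also have "\<dots> \<le> 2 * (cmod (x n))\<^sup>2 + 2 * (cmod (y n))\<^sup>2"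
    using zero_le_power2[of "cmod (x n) - cmod (y n)"]
    by (simp add: power2_sum power2_diff)
  finally show "norm ((cmod (x n + y n))\<^sup>2) \<le> 2 * (cmod (x n))\<^sup>2 + 2 * (cmod (y n))\<^sup>2"
    by simp
qed

lemma square_summable_scale:
  fixes x :: "nat \<Rightarrow> complex"
  assumes "summable (\<lambda>n. (cmod (x n))\<^sup>2)"
  shows "summable (\<lambda>n. (cmod (c * x n))\<^sup>2)"
  using summable_mult[OF assms, of "(cmod c)\<^sup>2"] by (simp add: norm_mult power_mult_distrib)

lemma square_summable_mult:
  fixes x y :: "nat \<Rightarrow> 'a :: {real_normed_div_algebra, banach}"
  assumes "summable (\<lambda>n. (norm (x n))\<^sup>2)" "summable (\<lambda>n. (norm (y n))\<^sup>2)"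
  shows "summable (\<lambda>n. norm (x n * y n))" "summable (\<lambda>n. x n * y n)"
proof -
  have *: "norm (x n * y n) \<le> (norm (x n))\<^sup>2 + (norm (y n))\<^sup>2" for n
    using sum_squares_bound[of "norm (x n)" "norm (y n)"]
      mult_nonneg_nonneg[OF norm_ge_zero[of "x n"] norm_ge_zero[of "y n"]]
    unfolding norm_mult by linarith
  show "summable (\<lambda>n. norm (x n * y n))"
    by (rule summable_comparison_test'[OF summable_add[OF assms]]) (use * in simp)
  then show "summable (\<lambda>n. x n * y n)"
    by (rule summable_norm_cancel)
qed

typedef ell2 = "{x :: nat \<Rightarrow> complex. summable (\<lambda>n. (cmod (x n))\<^sup>2)}"
  morphisms ell2_nth Abs_ell2
  by (rule exI[of _ "\<lambda>_. 0"]) simp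

setup_lifting type_definition_ell2

lemma ell2_eqI: "(\<And>n. ell2_nth x n = ell2_nth y n) \<Longrightarrow> x = y"
  by (auto simp: ell2_nth_inject[symmetric])

lemma summable_ell2: "summable (\<lambda>n. (cmod (ell2_nth x n))\<^sup>2)"
  using ell2_nth[of x] by simp

instantiation ell2 :: real_inner
begin

lift_definition zero_ell2 :: ell2 is "\<lambda>_. 0" by simp

lift_definition plus_ell2 :: "ell2 \<Rightarrow> ell2 \<Rightarrow> ell2" is "\<lambda>x y n. x n + y n"
  by (rule square_summable_add)

lift_definition uminus_ell2 :: "ell2 \<Rightarrow> ell2" is "\<lambda>x n. - x n" by simp

lift_definition minus_ell2 :: "ell2 \<Rightarrow> ell2 \<Rightarrow> ell2" is "\<lambda>x y n. x n - y n"
  subgoal for x y using square_summable_add[of x "\<lambda>n. - y n"] by simp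
  done

lift_definition scaleR_ell2 :: "real \<Rightarrow> ell2 \<Rightarrow> ell2" is "\<lambda>r x n. r *\<^sub>R x n"
  subgoal for r x using square_summable_scale[of x "of_real r"] by (simp add: scaleR_conv_of_real)
  done

definition norm_ell2 :: "ell2 \<Rightarrow> real" where
  "norm_ell2 x = sqrt (\<Sum>n. (cmod (ell2_nth x n))\<^sup>2)"

text \<open>The real part of the complex inner product \<open>cinner\<close> defined below.\<close>

definition inner_ell2 :: "ell2 \<Rightarrow> ell2 \<Rightarrow> real" where
  "inner_ell2 x y = (\<Sum>n. Re (cnj (ell2_nth x n) * ell2_nth y n))"

definition dist_ell2 :: "ell2 \<Rightarrow> ell2 \<Rightarrow> real" where
  "dist_ell2 x y = norm (x - y)"

definition sgn_ell2 :: "ell2 \<Rightarrow> ell2" where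
  "sgn_ell2 x = inverse (norm x) *\<^sub>R x"

definition uniformity_ell2 :: "(ell2 \<times> ell2) filter" where
  "uniformity_ell2 = (INF e\<in>{0<..}. principal {(x, y). dist x y < e})"

definition open_ell2 :: "ell2 set \<Rightarrow> bool" where
  "open_ell2 U \<longleftrightarrow> (\<forall>x\<in>U. \<forall>\<^sub>F (x', y) in uniformity. x' = x \<longrightarrow> y \<in> U)"

lemma summable_cnj_mult: "summable (\<lambda>n. cnj (ell2_nth x n) * ell2_nth y n)"
  by (rule square_summable_mult) (simp_all add: summable_ell2)

lemma summable_Re_cnj_mult: "summable (\<lambda>n. Re (cnj (ell2_nth x n) * ell2_nth y n))"
  by (rule summable_Re[OF summable_cnj_mult])

instance
proof
  fix x y z :: ell2 and a b r :: real and U :: "ell2 set"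
  show "x + y + z = x + (y + z)" "x + y = y + x" "0 + x = x" "- x + x = 0" "x - y = x + - y"
    by (transfer; simp add: algebra_simps)+
  show "a *\<^sub>R (x + y) = a *\<^sub>R x + a *\<^sub>R y" "(a + b) *\<^sub>R x = a *\<^sub>R x + b *\<^sub>R x"
    "a *\<^sub>R b *\<^sub>R x = (a * b) *\<^sub>R x" "1 *\<^sub>R x = x"
    by (transfer; simp add: algebra_simps)+
  show "dist x y = norm (x - y)" "sgn x = inverse (norm x) *\<^sub>R x"
    by (simp_all add: dist_ell2_def sgn_ell2_def)
  show "uniformity = (INF e\<in>{0<..}. principal {(x, y :: ell2). dist x y < e})"
    by (rule uniformity_ell2_def)
  show "open U \<longleftrightarrow> (\<forall>x\<in>U. \<forall>\<^sub>F (x', y) in uniformity. x' = x \<longrightarrow> y \<in> U)"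
    by (rule open_ell2_def)
  show "inner x y = inner y x"
    by (simp add: inner_ell2_def algebra_simps)
  show "inner (x + y) z = inner x z + inner y z"
    using summable_Re_cnj_mult[of x z] summable_Re_cnj_mult[of y z]
    by (simp add: inner_ell2_def suminf_add plus_ell2.rep_eq algebra_simps)
  show "inner (r *\<^sub>R x) y = r * inner x y"
    using summable_Re_cnj_mult[of x y]
    by (simp add: inner_ell2_def suminf_mult[symmetric] scaleR_ell2.rep_eq algebra_simps)
  have inner_self: "inner x x = (\<Sum>n. (cmod (ell2_nth x n))\<^sup>2)" for x
    unfolding cmod_power2 by (simp add: inner_ell2_def power2_eq_square)
  show "0 \<le> inner x x"
    unfolding inner_self by (rule suminf_nonneg[OF summable_ell2]) simp
  show "inner x x = 0 \<longleftrightarrow> x = 0"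
    unfolding inner_self suminf_eq_zero_iff[OF summable_ell2 zero_le_power2]
    by (auto simp: zero_ell2.rep_eq intro: ell2_eqI)
  show "norm x = sqrt (inner x x)"
    by (simp add: norm_ell2_def inner_self)
qed

end

lift_definition scaleC :: "complex \<Rightarrow> ell2 \<Rightarrow> ell2" is "\<lambda>c x n. c * x n"
  by (rule square_summable_scale)

definition cinner :: "ell2 \<Rightarrow> ell2 \<Rightarrow> complex" where
  "cinner x y = (\<Sum>n. cnj (ell2_nth x n) * ell2_nth y n)"

lift_definition ell2_basis :: "nat \<Rightarrow> ell2" is "\<lambda>k n. if n = k then 1 else 0"
proof -
  fix k :: nat
  show "summable (\<lambda>n. (cmod (if n = k then 1 else 0))\<^sup>2)"
    by (rule summable_finite[of "{k}"]) auto
qed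

section \<open>Trace norm\<close>

definition bounded_op :: "(ell2 \<Rightarrow> ell2) \<Rightarrow> bool" where
  "bounded_op A \<longleftrightarrow> bounded_linear A \<and> (\<forall>c x. A (scaleC c x) = scaleC c (A x))"

definition hilbert_adjoint :: "(ell2 \<Rightarrow> ell2) \<Rightarrow> ell2 \<Rightarrow> ell2" where
  "hilbert_adjoint A = (THE B. bounded_op B \<and> (\<forall>x y. cinner (B x) y = cinner x (A y)))"

definition positive_op :: "(ell2 \<Rightarrow> ell2) \<Rightarrow> bool" where
  "positive_op P \<longleftrightarrow> bounded_op P \<and> (\<forall>x. cinner x (P x) \<in> \<real> \<and> 0 \<le> Re (cinner x (P x)))"

text \<open>\<open>|A|\<close>, the positive square root of \<open>A\<^sup>* A\<close>.\<close>

definition abs_op :: "(ell2 \<Rightarrow> ell2) \<Rightarrow> ell2 \<Rightarrow> ell2" where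
  "abs_op A = (THE P. positive_op P \<and> P \<circ> P = hilbert_adjoint A \<circ> A)"

text \<open>The trace of \<open>|A|\<close>; it takes the value \<open>\<infinity>\<close> if \<open>A\<close> is bounded but not trace class.
  For an \<open>A\<close> that is not a bounded operator it has no meaning.\<close>

definition trace_norm :: "(ell2 \<Rightarrow> ell2) \<Rightarrow> ennreal" where
  "trace_norm A = (\<Sum>n. ennreal (Re (cinner (ell2_basis n) (abs_op A (ell2_basis n)))))"

definition trace_class :: "(ell2 \<Rightarrow> ell2) \<Rightarrow> bool" where
  "trace_class A \<longleftrightarrow> bounded_op A \<and> trace_norm A < \<infinity>"

section \<open>GGT matrices\<close>

definition ggt_rho :: "(nat \<Rightarrow> complex) \<Rightarrow> nat \<Rightarrow> real" where
  "ggt_rho \<alpha> n = sqrt (1 - (cmod (\<alpha> n))\<^sup>2)"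

text \<open>\<open>ggt_prev \<alpha> k\<close> is \<open>\<alpha>\<close> at \<open>k - 1\<close>, with the convention that \<open>\<alpha>\<close> at \<open>-1\<close> is \<open>-1\<close>.\<close>

definition ggt_prev :: "(nat \<Rightarrow> complex) \<Rightarrow> nat \<Rightarrow> complex" where
  "ggt_prev \<alpha> k = (if k = 0 then -1 else \<alpha> (k - 1))"

definition ggt_entry :: "(nat \<Rightarrow> complex) \<Rightarrow> nat \<Rightarrow> nat \<Rightarrow> complex" where
  "ggt_entry \<alpha> k l =
     (if k \<le> l then - cnj (\<alpha> l) * ggt_prev \<alpha> k * of_real (\<Prod>m=k..<l. ggt_rho \<alpha> m)
      else if k = l + 1 then of_real (ggt_rho \<alpha> l)
      else 0)"

text \<open>For \<open>\<alpha>\<close> in the closed unit disk the series converge and the result is square-summable,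
  see \<open>ggt_nth\<close> below, so that \<open>Abs_ell2\<close> is applied within its domain.\<close>

definition GGT :: "(nat \<Rightarrow> complex) \<Rightarrow> ell2 \<Rightarrow> ell2" where
  "GGT \<alpha> x = Abs_ell2 (\<lambda>k. \<Sum>l. ggt_entry \<alpha> k l * ell2_nth x l)"

context
  fixes \<alpha> :: "nat \<Rightarrow> complex"
  assumes disk: "\<And>n. cmod (\<alpha> n) \<le> 1"
begin

private definition wt :: "nat \<Rightarrow> nat \<Rightarrow> real" where
  "wt k l = (if k \<le> l then cmod (\<alpha> l) * (\<Prod>m=k..<l. ggt_rho \<alpha> m) else 0)"

private definition tm :: "ell2 \<Rightarrow> nat \<Rightarrow> nat \<Rightarrow> complex" where
  "tm x k l =
     (if k \<le> l then - cnj (\<alpha> l) * of_real (\<Prod>m=k..<l. ggt_rho \<alpha> m) * ell2_nth x l else 0)"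

private lemma rho_nonneg: "0 \<le> ggt_rho \<alpha> n"
  using disk[of n] by (simp add: ggt_rho_def power_le_one)

private lemma rho_sq: "(ggt_rho \<alpha> n)\<^sup>2 = 1 - (cmod (\<alpha> n))\<^sup>2"
  using disk[of n] by (simp add: ggt_rho_def power_le_one)

private lemma sum_wt:
  "(\<Sum>l<N. (wt k l)\<^sup>2) = (if k \<le> N then 1 - (\<Prod>m=k..<N. ggt_rho \<alpha> m)\<^sup>2 else 0)"
proof (induction N)
  case (Suc N)
  consider "k \<le> N" | "k = Suc N" | "k > Suc N" by linarith
  then show ?case
    unfolding sum.lessThan_Suc Suc
    by cases (auto simp: wt_def power_mult_distrib rho_sq algebra_simps)
qed (auto simp: wt_def)

private lemma wt_le: "(\<Sum>l<N. (wt k l)\<^sup>2) \<le> 1"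
  unfolding sum_wt by auto

private lemma summable_wt: "summable (\<lambda>l. (wt k l)\<^sup>2)"
  by (rule summableI_nonneg_bounded[OF _ wt_le]) simp

private lemma suminf_wt: "(\<Sum>l. (wt k l)\<^sup>2) \<le> 1"
  by (rule suminf_le_const[OF summable_wt wt_le])

private lemma norm_tm: "cmod (tm x k l) = wt k l * cmod (ell2_nth x l)"
  using rho_nonneg by (auto simp: tm_def wt_def norm_mult prod_nonneg abs_mult simp flip: prod_norm)

private lemma wt_nonneg: "0 \<le> wt k l"
  using rho_nonneg by (auto simp: wt_def intro!: mult_nonneg_nonneg prod_nonneg)

private lemma summable_norm_tm: "summable (\<lambda>l. cmod (tm x k l))"
  using square_summable_mult(1)[of "wt k" "\<lambda>l. cmod (ell2_nth x l)"]
  by (simp add: norm_tm summable_wt summable_ell2 abs_mult wt_nonneg)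

private lemma summable_tm: "summable (tm x k)"
  by (rule summable_norm_cancel[OF summable_norm_tm])

private lemma norm_sq: "(norm x)\<^sup>2 = (\<Sum>l. (cmod (ell2_nth x l))\<^sup>2)"
  by (simp add: norm_ell2_def suminf_nonneg summable_ell2)

private lemma suminf_tm_bound: "cmod (\<Sum>l. tm x k l) \<le> norm x"
proof (cases "x = 0")
  case True
  then have "tm x k = (\<lambda>_. 0)" by (auto simp: tm_def zero_ell2.rep_eq)
  then show ?thesis by simp
next
  case False
  define c where "c = norm x"
  have c: "c > 0" using False by (simp add: c_def)
  have "cmod (\<Sum>l. tm x k l) \<le> (\<Sum>l. cmod (tm x k l))"
    by (rule summable_norm[OF summable_norm_tm])
  also have "\<dots> \<le> (\<Sum>l. c / 2 * (wt k l)\<^sup>2 + 1 / (2 * c) * (cmod (ell2_nth x l))\<^sup>2)"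
  proof (rule suminf_le[OF _ summable_norm_tm])
    show "summable (\<lambda>l. c / 2 * (wt k l)\<^sup>2 + 1 / (2 * c) * (cmod (ell2_nth x l))\<^sup>2)"
      by (intro summable_add summable_mult summable_wt summable_ell2)
    fix l
    have "0 \<le> (c * wt k l - cmod (ell2_nth x l))\<^sup>2 / (2 * c)" using c by simp
    also have "\<dots> = c / 2 * (wt k l)\<^sup>2 + 1 / (2 * c) * (cmod (ell2_nth x l))\<^sup>2 - cmod (tm x k l)"
      using c by (simp add: norm_tm field_simps power2_eq_square)
    finally show "cmod (tm x k l) \<le> c / 2 * (wt k l)\<^sup>2 + 1 / (2 * c) * (cmod (ell2_nth x l))\<^sup>2"
      by simp
  qed
  also have "\<dots> = c / 2 * (\<Sum>l. (wt k l)\<^sup>2) + 1 / (2 * c) * (\<Sum>l. (cmod (ell2_nth x l))\<^sup>2)"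
    using summable_wt[of k] summable_ell2[of x]
    by (simp add: suminf_add[symmetric] suminf_mult summable_mult summable_divide suminf_divide)
  also have "\<dots> \<le> c / 2 * 1 + 1 / (2 * c) * c\<^sup>2"
    using c suminf_wt[of k] by (intro add_mono mult_left_mono) (simp_all add: c_def norm_sq)
  also have "\<dots> = norm x" using c by (simp add: c_def power2_eq_square)
  finally show ?thesis .
qed

private lemma tm_rec:
  "(\<Sum>l. tm x k l) = - cnj (\<alpha> k) * ell2_nth x k + of_real (ggt_rho \<alpha> k) * (\<Sum>l. tm x (Suc k) l)"
proof -
  have "tm x k l = (if l = k then - cnj (\<alpha> k) * ell2_nth x k else 0)
      + of_real (ggt_rho \<alpha> k) * tm x (Suc k) l" for l
    using prod.atLeast_Suc_lessThan[of k l "ggt_rho \<alpha>"]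
    by (cases l k rule: linorder_cases) (auto simp: tm_def)
  then have "tm x k = (\<lambda>l. (if l = k then - cnj (\<alpha> k) * ell2_nth x k else 0)
      + of_real (ggt_rho \<alpha> k) * tm x (Suc k) l)"
    by blast
  moreover have "(\<lambda>l. (if l = k then - cnj (\<alpha> k) * ell2_nth x k else 0)
      + of_real (ggt_rho \<alpha> k) * tm x (Suc k) l) sums
      (- cnj (\<alpha> k) * ell2_nth x k + of_real (ggt_rho \<alpha> k) * (\<Sum>l. tm x (Suc k) l))"
    using sums_single[of k "\<lambda>_. - cnj (\<alpha> k) * ell2_nth x k"]
    by (intro sums_add sums_mult summable_sums[OF summable_tm]) simp
  ultimately show ?thesis by (metis sums_unique)
qed

private lemma entry_sums:
  "(\<lambda>l. ggt_entry \<alpha> k l * ell2_nth x l) sums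
     (ggt_prev \<alpha> k * (\<Sum>l. tm x k l)
        + (if k = 0 then 0 else of_real (ggt_rho \<alpha> (k - 1)) * ell2_nth x (k - 1)))"
proof -
  let ?s = "\<lambda>l. if k \<noteq> 0 \<and> l = k - 1 then of_real (ggt_rho \<alpha> l) * ell2_nth x l else 0"
  have "(\<lambda>l. ggt_entry \<alpha> k l * ell2_nth x l) = (\<lambda>l. ggt_prev \<alpha> k * tm x k l + ?s l)"
    by (auto simp: ggt_entry_def tm_def fun_eq_iff)
  moreover have "?s sums (if k = 0 then 0 else of_real (ggt_rho \<alpha> (k - 1)) * ell2_nth x (k - 1))"
    using sums_single[of "k - 1" "\<lambda>l. of_real (ggt_rho \<alpha> l) * ell2_nth x l"] by (cases "k = 0") auto
  ultimately show ?thesis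
    by (auto intro!: sums_add sums_mult summable_sums[OF summable_tm])
qed

lemma ggt_summable: "summable (\<lambda>l. ggt_entry \<alpha> k l * ell2_nth x l)"
  by (rule sums_summable[OF entry_sums])

private lemma two_by_two:
  "(cmod (- cnj (\<alpha> k) * u + of_real (ggt_rho \<alpha> k) * v))\<^sup>2
     + (cmod (\<alpha> k * v + of_real (ggt_rho \<alpha> k) * u))\<^sup>2 = (cmod u)\<^sup>2 + (cmod v)\<^sup>2"
proof -
  have "(cmod (- cnj (\<alpha> k) * u + of_real (ggt_rho \<alpha> k) * v))\<^sup>2
     + (cmod (\<alpha> k * v + of_real (ggt_rho \<alpha> k) * u))\<^sup>2
     = ((cmod (\<alpha> k))\<^sup>2 + (ggt_rho \<alpha> k)\<^sup>2) * ((cmod u)\<^sup>2 + (cmod v)\<^sup>2)"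
    unfolding cmod_power2 by (simp add: power2_eq_square algebra_simps)
  then show ?thesis by (simp add: rho_sq)
qed

private lemma row_norms:
  fixes x :: ell2
  defines "y \<equiv> \<lambda>k. \<Sum>l. ggt_entry \<alpha> k l * ell2_nth x l"
  shows "(\<Sum>k<Suc N. (cmod (y k))\<^sup>2)
    = (\<Sum>k<N. (cmod (ell2_nth x k))\<^sup>2) + (cmod (\<Sum>l. tm x N l))\<^sup>2"
proof (induction N)
  case 0
  have "y 0 = - (\<Sum>l. tm x 0 l)"
    using sums_unique[OF entry_sums[of 0 x]] by (simp add: y_def ggt_prev_def)
  then show ?case by simp
next
  case (Suc N)
  have "y (Suc N) = \<alpha> N * (\<Sum>l. tm x (Suc N) l) + of_real (ggt_rho \<alpha> N) * ell2_nth x N"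
    using sums_unique[OF entry_sums[of "Suc N" x]] by (simp add: y_def ggt_prev_def)
  then show ?case
    using Suc two_by_two[of N "ell2_nth x N" "\<Sum>l. tm x (Suc N) l"] tm_rec[of x N] by simp
qed

private lemma row_bound:
  "(\<Sum>k<N. (cmod (\<Sum>l. ggt_entry \<alpha> k l * ell2_nth x l))\<^sup>2) \<le> 2 * (norm x)\<^sup>2"
proof -
  have "(\<Sum>k<N. (cmod (\<Sum>l. ggt_entry \<alpha> k l * ell2_nth x l))\<^sup>2)
      \<le> (\<Sum>k<Suc N. (cmod (\<Sum>l. ggt_entry \<alpha> k l * ell2_nth x l))\<^sup>2)" by simp
  also have "\<dots> \<le> (norm x)\<^sup>2 + (norm x)\<^sup>2"
    unfolding row_norms
  proof (rule add_mono)
    show "(\<Sum>k<N. (cmod (ell2_nth x k))\<^sup>2) \<le> (norm x)\<^sup>2"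
      unfolding norm_sq by (rule sum_le_suminf[OF summable_ell2]) auto
    show "(cmod (\<Sum>l. tm x N l))\<^sup>2 \<le> (norm x)\<^sup>2"
      by (intro power_mono suminf_tm_bound norm_ge_zero)
  qed
  finally show ?thesis by simp
qed

lemma ggt_nth: "ell2_nth (GGT \<alpha> x) k = (\<Sum>l. ggt_entry \<alpha> k l * ell2_nth x l)"
proof -
  have "summable (\<lambda>k. (cmod (\<Sum>l. ggt_entry \<alpha> k l * ell2_nth x l))\<^sup>2)"
    by (rule summableI_nonneg_bounded[OF _ row_bound]) simp
  then show ?thesis by (simp add: GGT_def Abs_ell2_inverse)
qed

lemma bounded_op_GGT: "bounded_op (GGT \<alpha>)"
  unfolding bounded_op_def
proof (intro conjI allI)
  show "bounded_linear (GGT \<alpha>)"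
  proof (rule bounded_linear_intro[where K = "sqrt 2"])
    show "GGT \<alpha> (x + y) = GGT \<alpha> x + GGT \<alpha> y" for x y
      by (rule ell2_eqI)
        (simp add: ggt_nth plus_ell2.rep_eq distrib_left suminf_add[symmetric] ggt_summable)
    show "GGT \<alpha> (r *\<^sub>R x) = r *\<^sub>R GGT \<alpha> x" for r x
      by (rule ell2_eqI)
        (simp add: ggt_nth scaleR_ell2.rep_eq suminf_scaleR_right[symmetric] ggt_summable)
    fix x
    have "(norm (GGT \<alpha> x))\<^sup>2 \<le> 2 * (norm x)\<^sup>2"
      unfolding norm_sq[of "GGT \<alpha> x"]
      by (rule suminf_le_const[OF summable_ell2]) (unfold ggt_nth, rule row_bound)
    then have "norm (GGT \<alpha> x) \<le> sqrt (2 * (norm x)\<^sup>2)"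
      by (rule real_le_rsqrt)
    then show "norm (GGT \<alpha> x) \<le> norm x * sqrt 2"
      by (simp add: real_sqrt_mult mult.commute)
  qed
  show "GGT \<alpha> (scaleC c x) = scaleC c (GGT \<alpha> x)" for c x
    by (rule ell2_eqI)
      (simp add: ggt_nth scaleC.rep_eq suminf_mult[OF ggt_summable, symmetric] mult.left_commute[of _ c])
qed

lemma GGT_matrix_elements: "cinner (ell2_basis k) (GGT \<alpha> (ell2_basis l)) = ggt_entry \<alpha> k l"
proof -
  have 1: "(\<lambda>n. cnj (ell2_nth (ell2_basis k) n) * z n) sums z k" for z
  proof -
    have "(\<lambda>n. cnj (ell2_nth (ell2_basis k) n) * z n) = (\<lambda>n. if n = k then z n else 0)"
      by (auto simp: ell2_basis.rep_eq)
    then show ?thesis using sums_single[of k z] by simp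
  qed
  have 2: "(\<lambda>n. z n * ell2_nth (ell2_basis l) n) sums z l" for z
  proof -
    have "(\<lambda>n. z n * ell2_nth (ell2_basis l) n) = (\<lambda>n. if n = l then z n else 0)"
      by (auto simp: ell2_basis.rep_eq)
    then show ?thesis using sums_single[of l z] by simp
  qed
  show ?thesis
    unfolding cinner_def by (simp add: sums_unique[OF 1, symmetric] ggt_nth sums_unique[OF 2, symmetric])
qed

end

end

theory Submission
  imports Defs
begin

text \<open>A GGT matrix is an infinite product \<open>\<Theta>\<^sub>0 \<Theta>\<^sub>1 \<Theta>\<^sub>2 \<dots>\<close>, in which \<open>\<Theta>\<^sub>n\<close> is a unitary \<open>2 \<times> 2\<close> block on
  the span of \<open>e\<^sub>n\<close> and \<open>e\<^sub>n\<^sub>+\<^sub>1\<close> with entries \<open>cnj \<alpha>\<^sub>n\<close>, \<open>\<rho>\<^sub>n\<close>, \<open>\<rho>\<^sub>n\<close>, \<open>- \<alpha>\<^sub>n\<close>. Replacing the blocks of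
  \<open>\<beta>\<close> by those of \<open>\<alpha>\<close> one at a time writes the difference of the two matrices as a sum over \<open>n\<close> of
  a block difference between two contractions. A block difference is the sum of four rank one
  matrices, one for each entry, so its trace norm is at most \<open>2 (|\<alpha>\<^sub>n - \<beta>\<^sub>n| + |\<rho>\<^sub>n - \<sigma>\<^sub>n|)\<close>. This is
  \<open>ggt_hybrid_step\<close> with \<open>ggt_step_trace_bound\<close>.

  To add these estimates the triangle inequality is taken in its dual form (\<open>trace_norm_le\<close>): the
  trace norm of \<open>A\<close> is at most \<open>T\<close> if \<open>Re (\<Sum>n<N. \<langle>e\<^sub>n, W A e\<^sub>n\<rangle>) \<le> T\<close> for all contractions \<open>W\<close> and
  all \<open>N\<close>. Only the action of \<open>A\<close> on finitely many basis vectors enters, and there the telescoping sum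
  has finitely many terms; so it is never summed as a series of operators, and an infinite bound is
  no exception.

  The dual form rests on facts about operators on a Hilbert space: the space is complete, a bounded
  operator has an adjoint, and a positive operator has exactly one positive square root
  (\<open>positive_sqrt_unique\<close>), which makes \<open>|A|\<close> meaningful. Then \<open>W = (|A| + e)\<^sup>-\<^sup>1 A\<^sup>*\<close> is a contraction
  with \<open>W A\<close> close to \<open>|A|\<close> (\<open>approximate_polar_decomposition\<close>), and this carries a bound for
  \<open>\<langle>e\<^sub>n, W A e\<^sub>n\<rangle>\<close> over to \<open>\<langle>e\<^sub>n, |A| e\<^sub>n\<rangle>\<close>.\<close>

section \<open>The Hilbert space of square-summable sequences\<close>

lemmas ell2_nth_simps =
  zero_ell2.rep_eq plus_ell2.rep_eq minus_ell2.rep_eq scaleR_ell2.rep_eq scaleC.rep_eq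
  ell2_basis.rep_eq

lemma power2_norm_ell2: "(norm x)\<^sup>2 = (\<Sum>n. (cmod (ell2_nth x n))\<^sup>2)"
  by (simp add: norm_ell2_def suminf_nonneg summable_ell2)

lemma sum_ell2_nth_le_norm: "(\<Sum>n<N. (cmod (ell2_nth x n))\<^sup>2) \<le> (norm x)\<^sup>2"
  unfolding power2_norm_ell2 by (rule sum_le_suminf[OF summable_ell2]) auto

lemma norm_ell2_le:
  assumes "\<And>N. (\<Sum>n<N. (cmod (ell2_nth x n))\<^sup>2) \<le> b\<^sup>2" "0 \<le> b"
  shows "norm x \<le> b"
proof -
  have "(norm x)\<^sup>2 \<le> b\<^sup>2"
    unfolding power2_norm_ell2 by (rule suminf_le_const[OF summable_ell2 assms(1)])
  then show ?thesis using assms(2) by (rule power2_le_imp_le)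
qed

lemma cmod_ell2_nth_le: "cmod (ell2_nth x n) \<le> norm x"
proof -
  have "(cmod (ell2_nth x n))\<^sup>2 \<le> (\<Sum>k<Suc n. (cmod (ell2_nth x k))\<^sup>2)"
    by (simp add: sum_nonneg)
  also have "\<dots> \<le> (norm x)\<^sup>2" by (rule sum_ell2_nth_le_norm)
  finally show ?thesis by (rule power2_le_imp_le) simp
qed

text \<open>A Cauchy sequence converges in every coordinate, and the Cauchy estimate for a partial sum
  of squares passes to the coordinatewise limit; so the limit is square-summable, and it is also
  the limit in norm.\<close>

instance ell2 :: banach
proof
  fix X :: "nat \<Rightarrow> ell2"
  assume X: "Cauchy X"
  have "Cauchy (\<lambda>n. ell2_nth (X n) k)" for k
  proof (rule metric_CauchyI)
    fix e :: real assume "0 < e"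
    then obtain M where M: "\<And>m n. m \<ge> M \<Longrightarrow> n \<ge> M \<Longrightarrow> dist (X m) (X n) < e"
      using metric_CauchyD[OF X] by blast
    have "dist (ell2_nth (X m) k) (ell2_nth (X n) k) \<le> dist (X m) (X n)" for m n
      using cmod_ell2_nth_le[of "X m - X n" k] by (simp add: dist_norm minus_ell2.rep_eq)
    then show "\<exists>M. \<forall>m\<ge>M. \<forall>n\<ge>M. dist (ell2_nth (X m) k) (ell2_nth (X n) k) < e"
      using M by (meson order_le_less_trans)
  qed
  then obtain l where l: "\<And>k. (\<lambda>n. ell2_nth (X n) k) \<longlonglongrightarrow> l k"
    unfolding Cauchy_convergent_iff convergent_def by metis
  have bound: "\<exists>M. \<forall>n\<ge>M. \<forall>N. (\<Sum>k<N. (cmod (ell2_nth (X n) k - l k))\<^sup>2) \<le> e\<^sup>2" if "0 < e" for e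
  proof -
    obtain M where M: "\<And>m n. m \<ge> M \<Longrightarrow> n \<ge> M \<Longrightarrow> dist (X m) (X n) < e"
      using metric_CauchyD[OF X \<open>0 < e\<close>] by blast
    have "(\<Sum>k<N. (cmod (ell2_nth (X n) k - l k))\<^sup>2) \<le> e\<^sup>2" if n: "n \<ge> M" for n N
    proof (rule LIMSEQ_le_const2)
      show "(\<lambda>m. \<Sum>k<N. (cmod (ell2_nth (X n) k - ell2_nth (X m) k))\<^sup>2)
          \<longlonglongrightarrow> (\<Sum>k<N. (cmod (ell2_nth (X n) k - l k))\<^sup>2)"
        by (intro tendsto_intros l)
      have "(\<Sum>k<N. (cmod (ell2_nth (X n) k - ell2_nth (X m) k))\<^sup>2) \<le> e\<^sup>2" if m: "m \<ge> M" for m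
      proof -
        have "(\<Sum>k<N. (cmod (ell2_nth (X n) k - ell2_nth (X m) k))\<^sup>2) \<le> (norm (X n - X m))\<^sup>2"
          using sum_ell2_nth_le_norm[of "X n - X m" N] by (simp add: minus_ell2.rep_eq)
        also have "\<dots> \<le> e\<^sup>2"
          using M[OF n m] by (intro power_mono) (simp_all add: dist_norm)
        finally show ?thesis .
      qed
      then show "\<exists>M. \<forall>m\<ge>M. (\<Sum>k<N. (cmod (ell2_nth (X n) k - ell2_nth (X m) k))\<^sup>2) \<le> e\<^sup>2"
        by blast
    qed
    then show ?thesis by blast
  qed
  have "summable (\<lambda>k. (cmod (l k))\<^sup>2)"
  proof -
    obtain M where M: "\<And>N. (\<Sum>k<N. (cmod (ell2_nth (X M) k - l k))\<^sup>2) \<le> 1\<^sup>2"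
      using bound[of 1] by auto
    have "summable (\<lambda>k. (cmod (ell2_nth (X M) k - l k))\<^sup>2)"
      by (rule summableI_nonneg_bounded[OF _ M]) simp
    then have "summable (\<lambda>k. (cmod (ell2_nth (X M) k + - (ell2_nth (X M) k - l k)))\<^sup>2)"
      by (intro square_summable_add summable_ell2) (simp add: norm_minus_commute)
    then show ?thesis by simp
  qed
  then have L: "ell2_nth (Abs_ell2 l) = l" by (simp add: Abs_ell2_inverse)
  have "X \<longlonglongrightarrow> Abs_ell2 l"
  proof (rule metric_LIMSEQ_I)
    fix e :: real assume "0 < e"
    then obtain M where M: "\<And>n N. n \<ge> M \<Longrightarrow> (\<Sum>k<N. (cmod (ell2_nth (X n) k - l k))\<^sup>2) \<le> (e / 2)\<^sup>2"
      using bound[of "e / 2"] by auto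
    have "norm (X n - Abs_ell2 l) \<le> e / 2" if "n \<ge> M" for n
      using M[OF that] \<open>0 < e\<close> by (intro norm_ell2_le) (simp_all add: minus_ell2.rep_eq L)
    then show "\<exists>M. \<forall>n\<ge>M. dist (X n) (Abs_ell2 l) < e"
      using \<open>0 < e\<close> by (intro exI[of _ M]) (force simp: dist_norm)
  qed
  then show "convergent X" by (auto simp: convergent_def)
qed

section \<open>The complex inner product\<close>

text \<open>Both parts of \<^const>\<open>cinner\<close> are values of the real inner product, which is how facts
  about real inner product spaces are transferred to complex-linear operators.\<close>

lemma cinner_eq_Complex_inner: "cinner x y = Complex (inner x y) (inner (scaleC \<i> x) y)"
proof -
  have "Re (cinner x y) = inner x y"
    unfolding cinner_def inner_ell2_def
    by (rule bounded_linear.suminf[OF bounded_linear_Re summable_cnj_mult])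
  moreover have "Im (cinner x y) = inner (scaleC \<i> x) y"
    unfolding cinner_def inner_ell2_def
    by (subst bounded_linear.suminf[OF bounded_linear_Im summable_cnj_mult])
      (simp add: scaleC.rep_eq)
  ultimately show ?thesis by (simp add: complex_eq_iff)
qed

lemma scaleC_add_right: "scaleC c (x + y) = scaleC c x + scaleC c y"
  and scaleC_diff_right: "scaleC c (x - y) = scaleC c x - scaleC c y"
  and scaleC_scaleR: "scaleC c (r *\<^sub>R x) = r *\<^sub>R scaleC c x"
  and scaleC_scaleC: "scaleC c (scaleC d x) = scaleC (c * d) x"
  and scaleC_minus_one: "scaleC (-1) x = - x"
  and scaleC_one: "scaleC 1 x = x"
  by (auto intro!: ell2_eqI simp: ell2_nth_simps uminus_ell2.rep_eq algebra_simps)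

lemma norm_scaleC: "norm (scaleC c x) = cmod c * norm x"
  using summable_ell2[of x]
  by (simp add: norm_ell2_def scaleC.rep_eq norm_mult power_mult_distrib suminf_mult
      real_sqrt_mult)

lemma bounded_linear_scaleC: "bounded_linear (scaleC c)"
  by (rule bounded_linear_intro[where K = "cmod c"])
    (simp_all add: scaleC_add_right scaleC_scaleR norm_scaleC)

lemma cinner_add_right: "cinner x (y + z) = cinner x y + cinner x z"
  by (simp add: cinner_eq_Complex_inner inner_add_right complex_eq_iff)

lemma cinner_scaleR_right: "cinner x (r *\<^sub>R y) = of_real r * cinner x y"
  by (simp add: cinner_eq_Complex_inner complex_eq_iff)

lemma cinner_scaleC_right: "cinner x (scaleC c y) = c * cinner x y"
  unfolding cinner_def
  by (subst suminf_mult[OF summable_cnj_mult, symmetric]) (simp add: scaleC.rep_eq mult.left_commute)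

lemma cinner_commute: "cinner y x = cnj (cinner x y)"
proof -
  have "cnj (cinner x y) = (\<Sum>n. cnj (cnj (ell2_nth x n) * ell2_nth y n))"
    unfolding cinner_def by (rule bounded_linear.suminf[OF bounded_linear_cnj summable_cnj_mult])
  then show ?thesis by (simp add: cinner_def mult.commute)
qed

lemma inner_scaleC_left: "inner (scaleC c x) y = inner x (scaleC (cnj c) y)"
  unfolding inner_ell2_def by (simp add: scaleC.rep_eq algebra_simps)

lemma cinner_ell2_basis: "cinner (ell2_basis n) x = ell2_nth x n"
proof -
  have "(\<lambda>m. cnj (ell2_nth (ell2_basis n) m) * ell2_nth x m)
      = (\<lambda>m. if m = n then ell2_nth x m else 0)"
    by (auto simp: ell2_basis.rep_eq)
  then show ?thesis
    using sums_single[of n "ell2_nth x"] by (simp add: cinner_def sums_unique[symmetric])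
qed

lemma inner_ell2_basis: "inner (ell2_basis n) x = Re (ell2_nth x n)"
  using cinner_ell2_basis[of n x] by (simp add: cinner_eq_Complex_inner complex_eq_iff)

lemma norm_ell2_basis: "norm (ell2_basis n) = 1"
  using inner_ell2_basis[of n "ell2_basis n"] by (simp add: ell2_basis.rep_eq norm_eq_sqrt_inner)

lemma ell2_nth_sum: "ell2_nth (sum f A) k = (\<Sum>a\<in>A. ell2_nth (f a) k)"
  by (induction A rule: infinite_finite_induct) (simp_all add: ell2_nth_simps)

definition ell2_truncate :: "nat \<Rightarrow> (nat \<Rightarrow> complex) \<Rightarrow> ell2" where
  "ell2_truncate N z = (\<Sum>n<N. scaleC (z n) (ell2_basis n))"

lemma ell2_nth_truncate: "ell2_nth (ell2_truncate N z) k = (if k < N then z k else 0)"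
  by (simp add: ell2_truncate_def ell2_nth_sum ell2_nth_simps if_distrib[of "(*) _"] cong: if_cong)

lemma norm_truncate: "(norm (ell2_truncate N z))\<^sup>2 = (\<Sum>n<N. (cmod (z n))\<^sup>2)"
proof -
  have "(\<lambda>n. (cmod (ell2_nth (ell2_truncate N z) n))\<^sup>2)
      = (\<lambda>n. if n \<in> {..<N} then (cmod (z n))\<^sup>2 else 0)"
    by (auto simp: ell2_nth_truncate)
  then show ?thesis
    unfolding power2_norm_ell2 using sums_unique[OF sums_If_finite_set[of "{..<N}" "\<lambda>n. (cmod (z n))\<^sup>2"]]
    by simp
qed

text \<open>By Pythagoras the squared error is the tail of the series for \<open>\<parallel>x\<parallel>\<^sup>2\<close>.\<close>

lemma ell2_truncate_tendsto: "(\<lambda>N. ell2_truncate N (ell2_nth x)) \<longlonglongrightarrow> x"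
proof -
  have "(norm (ell2_truncate N (ell2_nth x) - x))\<^sup>2 = (norm x)\<^sup>2 - (\<Sum>n<N. (cmod (ell2_nth x n))\<^sup>2)" for N
  proof -
    have "(\<lambda>n. (cmod (ell2_nth (ell2_truncate N (ell2_nth x) - x) n))\<^sup>2)
      = (\<lambda>n. (cmod (ell2_nth x n))\<^sup>2 - (if n \<in> {..<N} then (cmod (ell2_nth x n))\<^sup>2 else 0))"
      by (auto simp: ell2_nth_truncate minus_ell2.rep_eq)
    then show ?thesis
      unfolding power2_norm_ell2
      using sums_unique[OF sums_diff[OF summable_sums[OF summable_ell2[of x]]
            sums_If_finite_set[of "{..<N}" "\<lambda>n. (cmod (ell2_nth x n))\<^sup>2"]]]
      by simp
  qed
  moreover have "(\<lambda>N. (norm x)\<^sup>2 - (\<Sum>n<N. (cmod (ell2_nth x n))\<^sup>2)) \<longlonglongrightarrow> (norm x)\<^sup>2 - (norm x)\<^sup>2"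
    using summable_LIMSEQ[OF summable_ell2[of x]]
    by (intro tendsto_intros) (simp add: power2_norm_ell2)
  ultimately have "(\<lambda>N. (norm (ell2_truncate N (ell2_nth x) - x))\<^sup>2) \<longlonglongrightarrow> 0" by simp
  then have "(\<lambda>N. sqrt ((norm (ell2_truncate N (ell2_nth x) - x))\<^sup>2)) \<longlonglongrightarrow> sqrt 0"
    by (rule tendsto_real_sqrt)
  then show ?thesis by (simp add: LIM_zero_iff tendsto_norm_zero_iff)
qed

section \<open>Adjoints\<close>

lemma bounded_op_bounded_linear: "bounded_op A \<Longrightarrow> bounded_linear A"
  and bounded_op_scaleC: "bounded_op A \<Longrightarrow> A (scaleC c x) = scaleC c (A x)"
  by (auto simp: bounded_op_def)

lemma bounded_op_comp: "bounded_op A \<Longrightarrow> bounded_op B \<Longrightarrow> bounded_op (A \<circ> B)"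
  unfolding bounded_op_def using bounded_linear_compose[of A B] by (simp add: o_def)

lemma bounded_op_diff: "bounded_op A \<Longrightarrow> bounded_op B \<Longrightarrow> bounded_op (\<lambda>x. A x - B x)"
  unfolding bounded_op_def by (auto intro: bounded_linear_sub simp: scaleC_diff_right)

lemma bounded_op_truncate:
  assumes "bounded_op A"
  shows "A (ell2_truncate N z) = (\<Sum>n<N. scaleC (z n) (A (ell2_basis n)))"
  unfolding ell2_truncate_def
  by (simp add: linear_sum[OF bounded_linear.linear[OF bounded_op_bounded_linear[OF assms]]]
      bounded_op_scaleC[OF assms])

text \<open>The adjoint \<open>B\<close> has to satisfy \<open>(B x)\<^sub>n = \<langle>A e\<^sub>n, x\<rangle>\<close>. With \<open>w = \<Sum>n<N. (B x)\<^sub>n e\<^sub>n\<close> this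
  gives \<open>\<parallel>w\<parallel>\<^sup>2 = \<langle>A w, x\<rangle> \<le> K \<parallel>w\<parallel> \<parallel>x\<parallel>\<close>, so the sequence is square-summable with norm at most
  \<open>K \<parallel>x\<parallel>\<close>.\<close>

lemma adjoint_exists:
  assumes "bounded_op A"
  obtains B where "bounded_op B" "\<And>x y. cinner (B x) y = cinner x (A y)"
proof -
  interpret A: bounded_linear A by (rule bounded_op_bounded_linear[OF assms])
  obtain K where K: "\<And>x. norm (A x) \<le> norm x * K" "K > 0" using A.pos_bounded by blast
  define z where "z x n = cinner (A (ell2_basis n)) x" for x n
  have bound: "(\<Sum>n<N. (cmod (z x n))\<^sup>2) \<le> (norm x * K)\<^sup>2" for x N
  proof -
    define s where "s = norm (ell2_truncate N (z x))"
    have "s\<^sup>2 = (\<Sum>n<N. Re (z x n * cnj (z x n)))"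
      unfolding s_def norm_truncate cmod_power2 by (simp add: power2_eq_square)
    also have "\<dots> = (\<Sum>n<N. inner x (scaleC (z x n) (A (ell2_basis n))))"
    proof (rule sum.cong[OF refl])
      fix n
      have "Re (cinner x (scaleC (z x n) (A (ell2_basis n)))) = Re (z x n * cnj (z x n))"
        by (simp add: cinner_scaleC_right z_def cinner_commute[of x])
      then show "Re (z x n * cnj (z x n)) = inner x (scaleC (z x n) (A (ell2_basis n)))"
        by (simp add: cinner_eq_Complex_inner)
    qed
    also have "\<dots> = inner x (A (ell2_truncate N (z x)))"
      by (simp add: bounded_op_truncate[OF assms] inner_sum_right)
    also have "\<dots> \<le> norm x * norm (A (ell2_truncate N (z x)))" by (rule norm_cauchy_schwarz)
    also have "\<dots> \<le> norm x * (s * K)"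
      unfolding s_def by (intro mult_left_mono K norm_ge_zero)
    finally have "s * s \<le> s * (norm x * K)" by (simp add: power2_eq_square algebra_simps)
    moreover have "0 \<le> s" by (simp add: s_def)
    ultimately have "s \<le> norm x * K"
      using K(2) by (cases "s = 0") (auto simp: mult_le_cancel_left)
    then show ?thesis
      using \<open>0 \<le> s\<close> unfolding norm_truncate[symmetric] s_def by (intro power_mono)
  qed
  define B where "B x = Abs_ell2 (z x)" for x
  have B: "ell2_nth (B x) n = cinner (A (ell2_basis n)) x" for x n
  proof -
    have "summable (\<lambda>n. (cmod (z x n))\<^sup>2)"
      by (rule summableI_nonneg_bounded[OF _ bound]) simp
    then show ?thesis by (simp add: B_def Abs_ell2_inverse z_def)
  qed
  show thesis
  proof
    show "bounded_op B"
      unfolding bounded_op_def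
    proof (intro conjI allI)
      show "bounded_linear B"
      proof (rule bounded_linear_intro[where K = K])
        show "B (x + y) = B x + B y" "B (r *\<^sub>R x) = r *\<^sub>R B x" for x y r
          by (rule ell2_eqI,
              simp add: B ell2_nth_simps cinner_add_right cinner_scaleR_right scaleR_conv_of_real)+
        show "norm (B x) \<le> norm x * K" for x
          using bound[of x] K(2) by (intro norm_ell2_le) (simp_all add: B z_def)
      qed
      show "B (scaleC c x) = scaleC c (B x)" for c x
        by (rule ell2_eqI) (simp add: B ell2_nth_simps cinner_scaleC_right)
    qed
    fix x y
    \<comment> \<open>By definition of \<open>B\<close> the identity holds for \<open>y\<close> in the span of the basis.\<close>
    have "(\<lambda>N. cinner x (A (ell2_truncate N (ell2_nth y)))) \<longlonglongrightarrow> cinner x (A y)"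
      unfolding cinner_eq_Complex_inner
      by (intro tendsto_Complex tendsto_intros A.tendsto ell2_truncate_tendsto)
    moreover have "cinner x (A (ell2_truncate N (ell2_nth y)))
        = (\<Sum>n<N. cnj (ell2_nth (B x) n) * ell2_nth y n)" for N
    proof -
      have "cinner x (\<Sum>n<N. f n) = (\<Sum>n<N. cinner x (f n))" for f
        by (induction N) (simp_all add: cinner_add_right, simp add: cinner_eq_Complex_inner complex_eq_iff)
      moreover have "cinner x (A (ell2_basis n)) = cnj (ell2_nth (B x) n)" for n
        unfolding B by (rule cinner_commute)
      ultimately show ?thesis
        by (simp add: bounded_op_truncate[OF assms] cinner_scaleC_right mult.commute)
    qed
    moreover have "(\<lambda>N. \<Sum>n<N. cnj (ell2_nth (B x) n) * ell2_nth y n) \<longlonglongrightarrow> cinner (B x) y"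
      unfolding cinner_def by (rule summable_LIMSEQ[OF summable_cnj_mult])
    ultimately show "cinner (B x) y = cinner x (A y)" by (simp add: LIMSEQ_unique)
  qed
qed

text \<open>The adjoint is determined by its inner products, so the definite description denotes it.\<close>

lemma hilbert_adjoint:
  assumes "bounded_op A"
  shows "bounded_op (hilbert_adjoint A)" "inner (hilbert_adjoint A x) y = inner x (A y)"
proof -
  obtain B where B: "bounded_op B" "\<And>x y. cinner (B x) y = cinner x (A y)"
    using adjoint_exists[OF assms] by blast
  have "hilbert_adjoint A = B"
    unfolding hilbert_adjoint_def
  proof (rule the_equality)
    fix B' assume B': "bounded_op B' \<and> (\<forall>x y. cinner (B' x) y = cinner x (A y))"
    show "B' = B"
    proof
      fix x
      have "inner (B' x) y = inner (B x) y" for y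
        using B' B(2) by (simp add: cinner_eq_Complex_inner)
      then show "B' x = B x" using vector_eq_rdot by blast
    qed
  qed (use B in blast)
  moreover have "inner (B x) y = inner x (A y)"
    using B(2)[of x y] by (simp add: cinner_eq_Complex_inner)
  ultimately show "bounded_op (hilbert_adjoint A)" "inner (hilbert_adjoint A x) y = inner x (A y)"
    using B(1) by auto
qed

section \<open>The positive square root\<close>

lemma Im_cinner_hermitian:
  assumes "bounded_op P" "\<And>x y. inner x (P y) = inner (P x) y"
  shows "Im (cinner x (P x)) = 0"
proof -
  have "inner (scaleC \<i> x) (P x) = inner (P x) (scaleC (cnj \<i>) x)"
    by (metis assms(2) bounded_op_scaleC[OF assms(1)] inner_scaleC_left)
  also have "\<dots> = - inner (scaleC \<i> x) (P x)"
    using inner_minus_right[of "P x" "scaleC \<i> x"]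
    by (simp add: inner_commute scaleC_scaleC flip: scaleC_minus_one)
  finally show ?thesis by (simp add: cinner_eq_Complex_inner)
qed

lemma positive_opI:
  assumes "bounded_op P" "\<And>x y. inner x (P y) = inner (P x) y" "\<And>x. 0 \<le> inner x (P x)"
  shows "positive_op P"
  using assms Im_cinner_hermitian[OF assms(1,2)]
  by (simp add: positive_op_def complex_is_Real_iff) (simp add: cinner_eq_Complex_inner)

lemma positive_op_bounded_op: "positive_op P \<Longrightarrow> bounded_op P"
  and positive_op_nonneg: "positive_op P \<Longrightarrow> 0 \<le> inner x (P x)"
  by (auto simp: positive_op_def cinner_eq_Complex_inner)

text \<open>Symmetry comes from positivity by polarization over \<open>\<complex>\<close>: the quadratic form is real at
  \<open>x + \<i> y\<close>, and its imaginary part there is \<open>\<langle>x, P y\<rangle> - \<langle>y, P x\<rangle>\<close>.\<close>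

lemma positive_op_hermitian:
  assumes "positive_op P"
  shows "inner x (P y) = inner (P x) y"
proof -
  have P: "bounded_op P" by (rule positive_op_bounded_op[OF assms])
  interpret P: bounded_linear P by (rule bounded_op_bounded_linear[OF P])
  have Im: "inner (scaleC \<i> z) (P z) = 0" for z
    using assms by (auto simp: positive_op_def complex_is_Real_iff cinner_eq_Complex_inner)
  have "inner (scaleC \<i> x - y) (P x + scaleC \<i> (P y)) = 0"
    using Im[of "x + scaleC \<i> y"]
    by (simp add: scaleC_add_right scaleC_scaleC scaleC_minus_one P.add bounded_op_scaleC[OF P])
  moreover have "inner (scaleC \<i> x) (scaleC \<i> (P y)) = inner x (P y)"
    by (simp add: inner_scaleC_left scaleC_scaleC scaleC_one)
  moreover have "inner y (scaleC \<i> (P y)) = 0"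
    using Im[of y] inner_minus_right[of y "scaleC \<i> (P y)"]
    by (simp add: inner_scaleC_left scaleC_scaleC flip: scaleC_minus_one)
  ultimately show ?thesis
    using Im[of x] by (simp add: inner_diff_left inner_add_right) (simp add: inner_commute)
qed

text \<open>If \<open>c\<close> is a bound for \<open>T\<close>, then \<open>\<langle>z, T z\<rangle> \<ge> 0\<close> at \<open>z = x - T x / c\<close> expands to the inequality
  \<open>T\<^sup>2 \<le> c T\<close>.\<close>

lemma positive_op_norm_bound:
  assumes "positive_op T"
  obtains c where "0 < c" "\<And>x. (norm (T x))\<^sup>2 \<le> c * inner x (T x)"
proof -
  interpret T: bounded_linear T
    by (rule bounded_op_bounded_linear[OF positive_op_bounded_op[OF assms]])
  obtain c where c: "\<And>x. norm (T x) \<le> norm x * c" "c > 0" using T.pos_bounded by blast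
  have "(norm (T x))\<^sup>2 \<le> c * inner x (T x)" for x
  proof -
    define y where "y = T x"
    have "inner y (T y) \<le> norm y * (norm y * c)"
      by (rule order_trans[OF norm_cauchy_schwarz]) (intro mult_left_mono c norm_ge_zero)
    then have y: "inner y (T y) \<le> c * (norm y)\<^sup>2" by (simp add: power2_eq_square mult_ac)
    have "0 \<le> c\<^sup>2 * inner (x - (1 / c) *\<^sub>R y) (T (x - (1 / c) *\<^sub>R y))"
      using positive_op_nonneg[OF assms] by simp
    also have "\<dots> = c\<^sup>2 * inner x y - 2 * c * (norm y)\<^sup>2 + inner y (T y)"
      using c(2) positive_op_hermitian[OF assms, of x y]
      by (simp add: T.diff T.scaleR inner_diff_left inner_diff_right y_def[symmetric]
          power2_norm_eq_inner inner_commute[of "T x"] field_simps) (simp add: power2_eq_square dot_square_norm algebra_simps)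
    also have "\<dots> \<le> c * (c * inner x y - (norm y)\<^sup>2)"
      using y by (simp add: algebra_simps power2_eq_square)
    finally show ?thesis using c(2) by (simp add: zero_le_mult_iff y_def)
  qed
  then show thesis using that c(2) by blast
qed

lemma positive_op_eq_zero:
  assumes "positive_op T" "inner x (T x) = 0"
  shows "T x = 0"
proof -
  obtain c where "(norm (T x))\<^sup>2 \<le> c * inner x (T x)"
    using positive_op_norm_bound[OF assms(1)] by blast
  then show ?thesis using assms(2) by simp
qed

text \<open>The solution \<open>Y = 1 - (1 - X)\<^sup>1\<^sup>/\<^sup>2\<close> of \<open>2 Y = X + Y\<^sup>2\<close> is the limit of this iteration.\<close>

primrec sqrt_iter :: "('a::real_normed_vector \<Rightarrow>\<^sub>L 'a) \<Rightarrow> nat \<Rightarrow> ('a \<Rightarrow>\<^sub>L 'a)" where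
  "sqrt_iter X 0 = 0"
| "sqrt_iter X (Suc n) = (1 / 2) *\<^sub>R (X + (sqrt_iter X n o\<^sub>L sqrt_iter X n))"

primrec sqrt_majorant :: "nat \<Rightarrow> real" where
  "sqrt_majorant 0 = 0"
| "sqrt_majorant (Suc n) = (1 / 2) * (1 + (sqrt_majorant n)\<^sup>2)"

lemma sqrt_majorant_bounds: "0 \<le> sqrt_majorant n" "sqrt_majorant n \<le> 1"
  by (induction n) (auto simp: power_le_one)

lemma sqrt_majorant_mono: "sqrt_majorant n \<le> sqrt_majorant (Suc n)"
  by (induction n) (auto intro!: power_mono sqrt_majorant_bounds simp del: sqrt_majorant.simps(2),
      auto intro!: power_mono sqrt_majorant_bounds)

lemma summable_sqrt_majorant: "summable (\<lambda>n. sqrt_majorant (Suc n) - sqrt_majorant n)"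
proof -
  have "incseq sqrt_majorant" by (rule incseq_SucI) (rule sqrt_majorant_mono)
  then obtain L where "sqrt_majorant \<longlonglongrightarrow> L"
    by (rule incseq_convergent[of _ 1]) (auto intro: sqrt_majorant_bounds)
  then show ?thesis by (rule telescope_summable)
qed

lemma norm_sqrt_iter:
  assumes "norm X \<le> 1"
  shows "norm (sqrt_iter X n) \<le> sqrt_majorant n"
proof (induction n)
  case (Suc n)
  have "norm (X + (sqrt_iter X n o\<^sub>L sqrt_iter X n))
      \<le> norm X + norm (sqrt_iter X n) * norm (sqrt_iter X n)"
    by (intro norm_triangle_le add_left_mono norm_blinfun_compose)
  also have "\<dots> \<le> 1 + sqrt_majorant n * sqrt_majorant n"
    using assms Suc sqrt_majorant_bounds by (intro add_mono mult_mono) auto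
  finally show ?case by (simp add: power2_eq_square)
qed simp

text \<open>The identity \<open>Y\<^sup>2 - Z\<^sup>2 = Y (Y - Z) + (Y - Z) Z\<close> bounds the steps of the operator iteration
  by those of the scalar iteration at \<open>X = 1\<close>, and the latter converges because it is increasing
  and bounded.\<close>

lemma norm_sqrt_iter_step:
  assumes "norm X \<le> 1"
  shows "norm (sqrt_iter X (Suc n) - sqrt_iter X n) \<le> sqrt_majorant (Suc n) - sqrt_majorant n"
proof (induction n)
  case 0
  then show ?case using assms by simp
next
  case (Suc n)
  define Y Z a b where "Y = sqrt_iter X (Suc n)" "Z = sqrt_iter X n"
    and "a = sqrt_majorant (Suc n)" "b = sqrt_majorant n"
  note defs = this
  have Y: "norm Y \<le> a" and Z: "norm Z \<le> b" and YZ: "norm (Y - Z) \<le> a - b"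
    using norm_sqrt_iter[OF assms] Suc by (auto simp only: defs)
  have ab: "0 \<le> a" "0 \<le> b" unfolding defs by (rule sqrt_majorant_bounds)+
  have "sqrt_iter X (Suc (Suc n)) - sqrt_iter X (Suc n) = (1 / 2) *\<^sub>R ((Y o\<^sub>L Y) - (Z o\<^sub>L Z))"
    unfolding defs by (simp add: scaleR_diff_right scaleR_add_right)
  also have "(Y o\<^sub>L Y) - (Z o\<^sub>L Z) = (Y o\<^sub>L (Y - Z)) + ((Y - Z) o\<^sub>L Z)"
    by (rule blinfun_eqI) (simp add: blinfun.bilinear_simps)
  finally have "norm (sqrt_iter X (Suc (Suc n)) - sqrt_iter X (Suc n))
      = 1 / 2 * norm ((Y o\<^sub>L (Y - Z)) + ((Y - Z) o\<^sub>L Z))" by simp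
  also have "\<dots> \<le> 1 / 2 * (norm Y * norm (Y - Z) + norm (Y - Z) * norm Z)"
    by (intro mult_left_mono norm_triangle_le add_mono norm_blinfun_compose) simp
  also have "\<dots> \<le> 1 / 2 * (a * (a - b) + (a - b) * b)"
    using Y Z YZ ab order_trans[OF norm_ge_zero YZ]
    by (intro mult_left_mono add_mono mult_mono) simp_all
  also have "\<dots> = sqrt_majorant (Suc (Suc n)) - sqrt_majorant (Suc n)"
    unfolding sqrt_majorant.simps(2)[of "Suc n"] defs(3)[symmetric]
    unfolding defs(3) sqrt_majorant.simps(2)[of n] defs(4)[symmetric]
    by (simp add: algebra_simps power2_eq_square)
  finally show ?case .
qed

lemma sqrt_iter_limit:
  fixes X :: "'a::{real_inner, banach} \<Rightarrow>\<^sub>L 'a"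
  assumes X: "norm X \<le> 1" "\<And>x y. inner x (X y) = inner (X x) y"
  obtains Y where "norm Y \<le> 1" "2 *\<^sub>R Y = X + (Y o\<^sub>L Y)" "\<And>x y. inner x (Y y) = inner (Y x) y"
    "\<And>Z. X o\<^sub>L Z = Z o\<^sub>L X \<Longrightarrow> Y o\<^sub>L Z = Z o\<^sub>L Y"
proof -
  have "summable (\<lambda>n. sqrt_iter X (Suc n) - sqrt_iter X n)"
    by (rule summable_comparison_test'[OF summable_sqrt_majorant norm_sqrt_iter_step[OF X(1)]])
  then obtain Y where "(\<lambda>n. \<Sum>i<n. sqrt_iter X (Suc i) - sqrt_iter X i) \<longlonglongrightarrow> Y"
    by (auto simp: summable_def sums_def)
  then have Y: "sqrt_iter X \<longlonglongrightarrow> Y"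
    unfolding sum_lessThan_telescope by simp
  have apply_lim: "(\<lambda>n. sqrt_iter X n x) \<longlonglongrightarrow> Y x" for x
    by (intro tendsto_intros Y)
  show thesis
  proof
    have "norm (sqrt_iter X n) \<le> 1" for n
      by (rule order_trans[OF norm_sqrt_iter[OF X(1)] sqrt_majorant_bounds(2)])
    then show "norm Y \<le> 1" by (intro LIMSEQ_le_const2[OF tendsto_norm[OF Y]]) auto
    have "(\<lambda>n. 2 *\<^sub>R sqrt_iter X (Suc n)) \<longlonglongrightarrow> 2 *\<^sub>R Y"
      by (intro tendsto_intros LIMSEQ_Suc Y)
    moreover have "(\<lambda>n. 2 *\<^sub>R sqrt_iter X (Suc n)) \<longlonglongrightarrow> X + (Y o\<^sub>L Y)"
      unfolding sqrt_iter.simps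
      by (simp add: tendsto_intros bounded_bilinear.tendsto[OF bounded_bilinear_blinfun_compose] Y)
    ultimately show "2 *\<^sub>R Y = X + (Y o\<^sub>L Y)" by (rule LIMSEQ_unique)
    have "inner x (sqrt_iter X n y) = inner (sqrt_iter X n x) y" for n x y
      by (induction n arbitrary: x y)
        (simp_all add: blinfun.bilinear_simps inner_add_left inner_add_right X(2))
    then show "inner x (Y y) = inner (Y x) y" for x y
      using tendsto_inner[OF tendsto_const apply_lim[of y], of x]
        tendsto_inner[OF apply_lim[of x] tendsto_const, of y]
      by (simp add: LIMSEQ_unique)
    fix Z assume XZ: "X o\<^sub>L Z = Z o\<^sub>L X"
    have XZ': "X (Z x) = Z (X x)" for x
      using XZ by (metis blinfun_apply_blinfun_compose)
    have "sqrt_iter X n (Z x) = Z (sqrt_iter X n x)" for n x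
      by (induction n arbitrary: x) (simp_all add: blinfun.bilinear_simps XZ')
    then have "Y (Z x) = Z (Y x)" for x
      using apply_lim[of "Z x"] blinfun.tendsto[OF tendsto_const apply_lim[of x], of Z]
      by (simp add: LIMSEQ_unique)
    then show "Y o\<^sub>L Z = Z o\<^sub>L Y" by (intro blinfun_eqI) simp
  qed
qed

text \<open>With \<open>c\<close> as in \<open>T\<^sup>2 \<le> c T\<close>, the operator \<open>X = 1 - T / c\<close> is a contraction, since
  \<open>\<parallel>X x\<parallel>\<^sup>2 = \<parallel>x\<parallel>\<^sup>2 - 2 \<langle>x, T x\<rangle> / c + \<parallel>T x\<parallel>\<^sup>2 / c\<^sup>2\<close>. So \<open>\<surd>c (1 - Y)\<close> is the square root, where \<open>Y\<close> is
  the solution of \<open>2 Y = X + Y\<^sup>2\<close>. That it commutes with everything that commutes with \<open>T\<close> gives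
  complex linearity here and uniqueness below.\<close>

lemma positive_sqrt_exists:
  assumes T: "positive_op T"
  obtains S where "positive_op S" "\<And>x. S (S x) = T x"
    "\<And>P x. bounded_linear P \<Longrightarrow> (\<And>x. T (P x) = P (T x)) \<Longrightarrow> S (P x) = P (S x)"
proof -
  have bT: "bounded_linear T"
    by (rule bounded_op_bounded_linear[OF positive_op_bounded_op[OF T]])
  obtain c where c: "0 < c" "\<And>x. (norm (T x))\<^sup>2 \<le> c * inner x (T x)"
    using positive_op_norm_bound[OF T] by blast
  define X where "X = id_blinfun - (1 / c) *\<^sub>R Blinfun T"
  have X: "X x = x - (1 / c) *\<^sub>R T x" for x
    by (simp add: X_def blinfun.bilinear_simps bounded_linear_Blinfun_apply[OF bT])
  have "norm (X x) \<le> norm x" for x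
  proof -
    have "(norm (X x))\<^sup>2 = (norm x)\<^sup>2 - 2 / c * inner x (T x) + (norm (T x))\<^sup>2 / c\<^sup>2"
      unfolding X power2_norm_eq_inner
      by (simp add: inner_diff_left inner_diff_right inner_commute field_simps power2_eq_square)
    also have "(norm (T x))\<^sup>2 / c\<^sup>2 \<le> (c * inner x (T x)) / c\<^sup>2"
      using c by (intro divide_right_mono) auto
    also have "\<dots> = 1 / c * inner x (T x)" using c(1) by (simp add: power2_eq_square)
    also have "(norm x)\<^sup>2 - 2 / c * inner x (T x) + 1 / c * inner x (T x) \<le> (norm x)\<^sup>2"
      using c(1) positive_op_nonneg[OF T, of x] by simp
    finally show ?thesis by (rule power2_le_imp_le) simp_all
  qed
  then have "norm X \<le> 1" by (intro norm_blinfun_bound) auto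
  moreover have "inner x (X y) = inner (X x) y" for x y
    by (simp add: X inner_diff_left inner_diff_right positive_op_hermitian[OF T])
  ultimately obtain Y where Y: "norm Y \<le> 1" "2 *\<^sub>R Y = X + (Y o\<^sub>L Y)"
    "\<And>x y. inner x (Y y) = inner (Y x) y" "\<And>Z. X o\<^sub>L Z = Z o\<^sub>L X \<Longrightarrow> Y o\<^sub>L Z = Z o\<^sub>L Y"
    using sqrt_iter_limit by blast
  define S where "S x = sqrt c *\<^sub>R (x - Y x)" for x
  have lS: "bounded_linear S"
    unfolding S_def by (intro bounded_linear_intros bounded_linear_sub)
  have comm: "S (P x) = P (S x)" if P: "bounded_linear P" "\<And>x. T (P x) = P (T x)" for P x
  proof -
    interpret P: bounded_linear P by fact
    have "X o\<^sub>L Blinfun P = Blinfun P o\<^sub>L X"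
      by (rule blinfun_eqI) (simp add: X bounded_linear_Blinfun_apply[OF P(1)] P(2) P.diff P.scaleR)
    from Y(4)[OF this] have "Y (P x) = P (Y x)"
      by (metis blinfun_apply_blinfun_compose bounded_linear_Blinfun_apply[OF P(1)])
    then show ?thesis by (simp add: S_def P.diff P.scaleR)
  qed
  show thesis
  proof
    show "positive_op S"
    proof (rule positive_opI)
      show "bounded_op S"
        unfolding bounded_op_def
        using lS comm[OF bounded_linear_scaleC] bounded_op_scaleC[OF positive_op_bounded_op[OF T]]
        by blast
      show "inner x (S y) = inner (S x) y" for x y
        by (simp add: S_def inner_diff_left inner_diff_right Y(3))
      have "inner x (Y x) \<le> inner x x" for x
      proof -
        have "inner x (Y x) \<le> norm x * norm (Y x)" by (rule norm_cauchy_schwarz)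
        also have "norm (Y x) \<le> 1 * norm x"
          by (rule order_trans[OF norm_blinfun mult_right_mono[OF Y(1) norm_ge_zero]])
        finally show ?thesis
          by (simp add: mult_left_mono dot_square_norm power2_eq_square)
      qed
      then show "0 \<le> inner x (S x)" for x using c(1) by (simp add: S_def inner_diff_right)
    qed
    show "S (S x) = T x" for x
    proof -
      have "2 *\<^sub>R Y x = X x + Y (Y x)"
        using arg_cong[OF Y(2), of "\<lambda>Z. blinfun_apply Z x"] by (simp add: blinfun.bilinear_simps)
      then have "x - 2 *\<^sub>R Y x + Y (Y x) = (1 / c) *\<^sub>R T x" by (simp add: X algebra_simps)
      moreover have "S (S x) = c *\<^sub>R (x - 2 *\<^sub>R Y x + Y (Y x))"
        using c(1)
        by (simp add: S_def blinfun.bilinear_simps scaleR_diff_right scaleR_add_right scaleR_2)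
      ultimately show ?thesis using c(1) by simp
    qed
  qed (fact comm)
qed

text \<open>Let \<open>D = S - P\<close>, where \<open>S\<close> is the root above, which commutes with any other root \<open>P\<close>. Then
  \<open>D S D + D P D = (S\<^sup>2 - P\<^sup>2) D = 0\<close> is a sum of positive operators, so \<open>S D = P D = 0\<close> and
  \<open>D\<^sup>2 = 0\<close>.\<close>

lemma positive_sqrt_unique:
  assumes T: "positive_op T"
  shows "\<exists>!S. positive_op S \<and> S \<circ> S = T"
proof -
  obtain S where S: "positive_op S" "\<And>x. S (S x) = T x"
    "\<And>P x. bounded_linear P \<Longrightarrow> (\<And>x. T (P x) = P (T x)) \<Longrightarrow> S (P x) = P (S x)"
    using positive_sqrt_exists[OF T] by blast
  have "P = S" if P: "positive_op P" "P \<circ> P = T" for P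
  proof
    fix x
    have bP: "bounded_linear P" and bS: "bounded_linear S"
      using P S positive_op_bounded_op bounded_op_bounded_linear by blast+
    interpret P: bounded_linear P by fact
    interpret S: bounded_linear S by fact
    have PP: "P (P y) = T y" for y using P(2) by auto
    then have SP: "S (P y) = P (S y)" for y by (intro S(3) bP) metis
    define D where "D y = S y - P y" for y
    have herm: "inner y (D z) = inner (D y) z" for y z
      by (simp add: D_def inner_diff_left inner_diff_right positive_op_hermitian S(1) P(1))
    have "inner (D x) (S (D x)) + inner (D x) (P (D x)) = inner (D x) (S (D x) + P (D x))"
      by (simp add: inner_add_right)
    also have "S (D x) + P (D x) = 0"
      by (simp add: D_def S.diff P.diff SP PP S(2))
    finally have "inner (D x) (S (D x)) = 0" "inner (D x) (P (D x)) = 0"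
      using positive_op_nonneg[OF S(1), of "D x"] positive_op_nonneg[OF P(1), of "D x"] by auto
    then have "S (D x) = 0" "P (D x) = 0"
      using positive_op_eq_zero S(1) P(1) by blast+
    then have "D (D x) = 0" using D_def[of "D x"] by simp
    then have "inner (D x) (D x) = 0" using herm[of x "D x"] by simp
    then show "P x = S x" by (simp add: D_def)
  qed
  moreover have "S \<circ> S = T" by (rule ext) (simp add: S(2))
  ultimately show ?thesis using S(1) by (intro ex1I[of _ S]) blast+
qed

lemma abs_op:
  assumes A: "bounded_op A"
  shows "positive_op (abs_op A)" "abs_op A (abs_op A x) = hilbert_adjoint A (A x)"
proof -
  have "positive_op (hilbert_adjoint A \<circ> A)"
    using hilbert_adjoint[OF A]
    by (intro positive_opI bounded_op_comp A) (simp_all add: inner_commute)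
  from theI'[OF positive_sqrt_unique[OF this]]
  have "positive_op (abs_op A) \<and> abs_op A \<circ> abs_op A = hilbert_adjoint A \<circ> A"
    unfolding abs_op_def .
  then show "positive_op (abs_op A)" "abs_op A (abs_op A x) = hilbert_adjoint A (A x)"
    by (auto simp: fun_eq_iff)
qed

section \<open>Duality for the trace norm\<close>

text \<open>This is the Lax-Milgram lemma. For small \<open>t > 0\<close> the map \<open>x \<mapsto> x - t (Q x - y)\<close> is a
  contraction, since \<open>\<parallel>z - t Q z\<parallel>\<^sup>2 \<le> (1 - 2 t e + t\<^sup>2 K\<^sup>2) \<parallel>z\<parallel>\<^sup>2\<close>; the choice \<open>t = e / K\<^sup>2\<close> minimizes the
  factor.\<close>

lemma coercive_surj:
  fixes Q :: "'a::{real_inner, banach} \<Rightarrow> 'a"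
  assumes Q: "bounded_linear Q" and e: "0 < e" "\<And>x. e * (norm x)\<^sup>2 \<le> inner x (Q x)"
  shows "\<exists>x. Q x = y"
proof -
  interpret Q: bounded_linear Q by fact
  obtain K0 where K0: "\<And>x. norm (Q x) \<le> norm x * K0" using Q.bounded by blast
  define K where "K = max K0 e"
  have K: "e \<le> K" "0 < K" using e(1) by (auto simp: K_def)
  have QK: "norm (Q x) \<le> K * norm x" for x
    using order_trans[OF K0[of x] mult_left_mono[of K0 K "norm x"]] by (simp add: K_def mult.commute)
  define t where "t = e / K\<^sup>2"
  define c where "c = sqrt (1 - e\<^sup>2 / K\<^sup>2)"
  have "e\<^sup>2 / K\<^sup>2 \<le> 1" using K e(1) by (simp add: divide_le_eq_1 power_mono)
  then have c: "0 \<le> c" "c < 1" "c\<^sup>2 = 1 - e\<^sup>2 / K\<^sup>2"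
    using e(1) K by (auto simp: c_def real_sqrt_lt_1_iff)
  have contr: "norm (z - t *\<^sub>R Q z) \<le> c * norm z" for z
  proof -
    have t: "0 \<le> t" using e(1) by (simp add: t_def)
    have "(norm (z - t *\<^sub>R Q z))\<^sup>2 = (norm z)\<^sup>2 - 2 * t * inner z (Q z) + t\<^sup>2 * (norm (Q z))\<^sup>2"
      unfolding power2_norm_eq_inner
      by (simp add: inner_diff_left inner_diff_right inner_commute algebra_simps power2_eq_square)
    also have "\<dots> \<le> (norm z)\<^sup>2 - 2 * t * (e * (norm z)\<^sup>2) + t\<^sup>2 * (K * norm z)\<^sup>2"
      using t e(2)[of z] QK[of z] by (intro add_mono diff_mono mult_left_mono power_mono) auto
    also have "\<dots> = (1 - 2 * (t * e) + t\<^sup>2 * K\<^sup>2) * (norm z)\<^sup>2"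
      by (simp add: power_mult_distrib algebra_simps)
    also have "\<dots> = (c * norm z)\<^sup>2"
    proof -
      have "t * e = e\<^sup>2 / K\<^sup>2" "t\<^sup>2 * K\<^sup>2 = e\<^sup>2 / K\<^sup>2"
        using K(2) by (simp_all add: t_def power_divide power2_eq_square)
      then have "1 - 2 * (t * e) + t\<^sup>2 * K\<^sup>2 = c\<^sup>2" using c(3) by linarith
      then show ?thesis by (simp only: power_mult_distrib)
    qed
    finally show ?thesis by (rule power2_le_imp_le) (simp add: c(1))
  qed
  define f where "f x = x - t *\<^sub>R (Q x - y)" for x
  have "dist (f x) (f x') \<le> c * dist x x'" for x x'
    using contr[of "x - x'"] by (simp add: f_def dist_norm Q.diff algebra_simps)
  then have "\<exists>!x. f x = x" using c by (intro banach_fix_type) auto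
  then obtain x where "f x = x" by blast
  then have "Q x = y" using e(1) K(2) by (simp add: f_def t_def)
  then show ?thesis by blast
qed

text \<open>In the polar decomposition \<open>A = V |A|\<close> the contraction \<open>V\<^sup>*\<close> satisfies \<open>V\<^sup>* A = |A|\<close>. An
  approximation to \<open>V\<^sup>*\<close> that needs no partial isometry is \<open>W = (|A| + e)\<^sup>-\<^sup>1 A\<^sup>*\<close>. Its error is
  \<open>|A| - W A = e (|A| + e)\<^sup>-\<^sup>1 |A|\<close>, and \<open>\<parallel>|A| x\<parallel> \<le> \<parallel>(|A| + e) x\<parallel>\<close> bounds the norm of that by \<open>e\<close>.\<close>

lemma approximate_polar_decomposition:
  assumes A: "bounded_op A" and e: "0 < e"
  obtains W where "bounded_op W" "\<And>x. norm (W x) \<le> norm x"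
    "\<And>x. norm (abs_op A x - W (A x)) \<le> e * norm x"
proof -
  define P where "P = abs_op A"
  have P: "positive_op P" and PP: "P (P x) = hilbert_adjoint A (A x)" for x
    using abs_op[OF A] by (auto simp: P_def)
  have bP: "bounded_op P" by (rule positive_op_bounded_op[OF P])
  interpret P: bounded_linear P by (rule bounded_op_bounded_linear[OF bP])
  define Q where "Q x = P x + e *\<^sub>R x" for x
  have bQ: "bounded_linear Q"
    unfolding Q_def
    by (intro bounded_linear_add P.bounded_linear_axioms bounded_linear_scaleR_right)
  interpret Q: bounded_linear Q by (rule bQ)
  have herm: "inner x (Q y) = inner (Q x) y" for x y
    by (simp add: Q_def inner_add_left inner_add_right positive_op_hermitian[OF P])
  have "(norm (Q x))\<^sup>2 = (norm (P x))\<^sup>2 + 2 * e * inner x (P x) + e\<^sup>2 * (norm x)\<^sup>2" for x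
    unfolding power2_norm_eq_inner
    by (simp add: Q_def inner_add_left inner_add_right inner_commute algebra_simps power2_eq_square)
  then have "(norm (P x))\<^sup>2 \<le> (norm (Q x))\<^sup>2" and "(e * norm x)\<^sup>2 \<le> (norm (Q x))\<^sup>2" for x
    using e positive_op_nonneg[OF P, of x] by (simp_all add: power_mult_distrib)
  then have P_le_Q: "norm (P x) \<le> norm (Q x)" and Q_below: "e * norm x \<le> norm (Q x)" for x
    by (meson power2_le_imp_le norm_ge_zero)+
  have injQ: "x = y" if "Q x = Q y" for x y
    using Q_below[of "x - y"] e that by (simp add: Q.diff mult_le_0_iff)
  have "\<exists>x. Q x = y" for y
    by (rule coercive_surj[OF bQ e])
      (use positive_op_nonneg[OF P] in \<open>simp add: Q_def inner_add_right power2_norm_eq_inner\<close>)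
  then obtain J where QJ: "\<And>y. Q (J y) = y" by metis
  have bJ: "bounded_op J"
    unfolding bounded_op_def
  proof (intro conjI allI bounded_linear_intro[where K = "1 / e"])
    show "J (x + y) = J x + J y" "J (r *\<^sub>R x) = r *\<^sub>R J x" for x y r
      by (rule injQ, simp add: QJ Q.add Q.scaleR)+
    show "norm (J x) \<le> norm x * (1 / e)" for x
      using Q_below[of "J x"] e by (simp add: QJ field_simps)
    have "Q (scaleC c x) = scaleC c (Q x)" for c x
      by (simp add: Q_def bounded_op_scaleC[OF bP] scaleC_add_right scaleC_scaleR)
    then show "J (scaleC c x) = scaleC c (J x)" for c x
      by - (rule injQ, simp add: QJ)
  qed
  define W where "W = J \<circ> hilbert_adjoint A"
  show thesis
  proof
    show "bounded_op W"
      unfolding W_def by (intro bounded_op_comp bJ hilbert_adjoint A)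
    show "norm (W u) \<le> norm u" for u
    proof -
      define w z where "w = W u" and "z = J w"
      have "inner (A z) (A z) = inner (P z) (P z)"
        using hilbert_adjoint(2)[OF A, of "A z" z] positive_op_hermitian[OF P, of "P z" z]
        by (simp add: PP inner_commute)
      then have Az: "norm (A z) = norm (P z)" by (simp add: norm_eq_sqrt_inner)
      have "norm w * norm w = inner (Q z) w"
        by (simp add: z_def QJ flip: power2_norm_eq_inner power2_eq_square)
      also have "\<dots> = inner z (hilbert_adjoint A u)"
        unfolding herm[symmetric] by (simp add: w_def W_def QJ)
      also have "\<dots> = inner u (A z)"
        using hilbert_adjoint(2)[OF A, of u z] by (simp add: inner_commute)
      also have "\<dots> \<le> norm u * norm (A z)" by (rule norm_cauchy_schwarz)
      also have "\<dots> \<le> norm u * norm w"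
        unfolding Az using P_le_Q[of z] by (intro mult_left_mono) (simp_all add: z_def QJ)
      finally show ?thesis
        unfolding w_def[symmetric] by (cases "w = 0") (auto simp: mult_le_cancel_right)
    qed
    show "norm (abs_op A x - W (A x)) \<le> e * norm x" for x
    proof -
      have "Q (P x - W (A x)) = Q (P x) - P (P x)"
        by (simp add: Q.diff W_def QJ PP)
      then have "Q (P x - W (A x)) = e *\<^sub>R P x"
        by (simp add: Q_def)
      also have "\<dots> = Q (e *\<^sub>R P (J x))"
      proof -
        have "Q (P (J x)) = P (Q (J x))" by (simp only: Q_def P.add P.scaleR)
        then show ?thesis by (simp only: Q.scaleR QJ)
      qed
      finally have "P x - W (A x) = e *\<^sub>R P (J x)" by (rule injQ)
      then show ?thesis
        using P_le_Q[of "J x"] e by (simp add: QJ P_def)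
    qed
  qed
qed

text \<open>One half of \<open>\<parallel>A\<parallel>\<^sub>1 = sup\<^sub>W |tr (W A)|\<close>, with the trace replaced by its partial sums. It turns
  a trace norm estimate into an estimate of finite sums that are linear in \<open>A\<close>.\<close>

lemma trace_norm_le:
  assumes A: "bounded_op A"
    and T: "\<And>W N. bounded_op W \<Longrightarrow> (\<And>x. norm (W x) \<le> norm x) \<Longrightarrow>
      ennreal (\<Sum>n<N. inner (ell2_basis n) (W (A (ell2_basis n)))) \<le> T"
  shows "trace_norm A \<le> T"
proof -
  have nonneg: "0 \<le> inner x (abs_op A x)" for x
    by (rule positive_op_nonneg[OF abs_op(1)[OF A]])
  have "ennreal (\<Sum>n<N. inner (ell2_basis n) (abs_op A (ell2_basis n))) \<le> T" for N
  proof (rule ennreal_le_epsilon)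
    fix e :: real assume e: "0 < e"
    obtain W where W: "bounded_op W" "\<And>x. norm (W x) \<le> norm x"
      "\<And>x. norm (abs_op A x - W (A x)) \<le> e / (N + 1) * norm x"
      using approximate_polar_decomposition[OF A, of "e / (N + 1)"] e by auto
    have "inner (ell2_basis n) (abs_op A (ell2_basis n))
        \<le> inner (ell2_basis n) (W (A (ell2_basis n))) + e / (N + 1)" for n
    proof -
      have "inner (ell2_basis n) (abs_op A (ell2_basis n) - W (A (ell2_basis n)))
          \<le> norm (ell2_basis n) * norm (abs_op A (ell2_basis n) - W (A (ell2_basis n)))"
        by (rule norm_cauchy_schwarz)
      also have "\<dots> \<le> e / (N + 1)" using W(3)[of "ell2_basis n"] by (simp add: norm_ell2_basis)
      finally show ?thesis by (simp add: inner_diff_right)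
    qed
    then have "(\<Sum>n<N. inner (ell2_basis n) (abs_op A (ell2_basis n)))
        \<le> (\<Sum>n<N. inner (ell2_basis n) (W (A (ell2_basis n))) + e / (N + 1))"
      by (rule sum_mono)
    also have "\<dots> = (\<Sum>n<N. inner (ell2_basis n) (W (A (ell2_basis n)))) + N * (e / (N + 1))"
      by (simp add: sum.distrib)
    also have "N * (e / (N + 1)) \<le> e" using e by (simp add: field_simps)
    finally have "ennreal (\<Sum>n<N. inner (ell2_basis n) (abs_op A (ell2_basis n)))
        \<le> ennreal ((\<Sum>n<N. inner (ell2_basis n) (W (A (ell2_basis n)))) + e)"
      by (intro ennreal_leI) simp
    also have "\<dots> \<le> ennreal (\<Sum>n<N. inner (ell2_basis n) (W (A (ell2_basis n)))) + ennreal e"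
      by (cases "0 \<le> (\<Sum>n<N. inner (ell2_basis n) (W (A (ell2_basis n))))")
        (use e in \<open>auto simp: ennreal_plus ennreal_neg intro!: ennreal_leI\<close>)
    also have "\<dots> \<le> T + ennreal e" using T[OF W(1,2)] by (intro add_right_mono)
    finally show "ennreal (\<Sum>n<N. inner (ell2_basis n) (abs_op A (ell2_basis n))) \<le> T + ennreal e" .
  qed
  then have "(\<Sum>n<N. ennreal (inner (ell2_basis n) (abs_op A (ell2_basis n)))) \<le> T" for N
    by (simp add: sum_ennreal nonneg)
  then show ?thesis
    unfolding trace_norm_def cinner_eq_Complex_inner complex.sel
    by (intro suminf_le_const summableI)
qed

text \<open>The rank one operator with matrix \<open>a u\<^sub>k v\<^sub>l\<close> contributes at most \<open>|a|\<close>, by Cauchy-Schwarz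
  for \<open>W u\<close> and \<open>v\<close>.\<close>

lemma rank_one_trace_bound:
  assumes W: "bounded_op W" "\<And>x. norm (W x) \<le> norm x"
    and u: "norm u \<le> 1" and v: "(\<Sum>l<N. (cmod (v l))\<^sup>2) \<le> 1"
  shows "(\<Sum>l<N. inner (ell2_basis l) (W (scaleC (a * v l) u))) \<le> cmod a"
proof -
  have "inner (ell2_basis l) (W (scaleC (a * v l) u)) \<le> cmod a * (cmod (v l) * cmod (ell2_nth (W u) l))" for l
    using complex_Re_le_cmod[of "a * v l * ell2_nth (W u) l"]
    by (simp add: inner_ell2_basis bounded_op_scaleC[OF W(1)] scaleC.rep_eq norm_mult mult.assoc)
  then have "(\<Sum>l<N. inner (ell2_basis l) (W (scaleC (a * v l) u)))
      \<le> cmod a * (\<Sum>l<N. cmod (v l) * cmod (ell2_nth (W u) l))"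
    unfolding sum_distrib_left by (rule sum_mono)
  also have "(\<Sum>l<N. cmod (v l) * cmod (ell2_nth (W u) l))
      \<le> L2_set (\<lambda>l. cmod (v l)) {..<N} * L2_set (\<lambda>l. cmod (ell2_nth (W u) l)) {..<N}"
    using L2_set_mult_ineq[of "\<lambda>l. cmod (v l)" "\<lambda>l. cmod (ell2_nth (W u) l)" "{..<N}"] by simp
  also have "\<dots> \<le> 1 * 1"
  proof (intro mult_mono)
    have "(\<Sum>l<N. (cmod (ell2_nth (W u) l))\<^sup>2) \<le> (norm (W u))\<^sup>2" by (rule sum_ell2_nth_le_norm)
    also have "\<dots> \<le> 1" using order_trans[OF W(2) u] by (simp add: power_le_one)
    finally show "L2_set (\<lambda>l. cmod (ell2_nth (W u) l)) {..<N} \<le> 1" by (simp add: L2_set_def)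
    show "L2_set (\<lambda>l. cmod (v l)) {..<N} \<le> 1" using v by (simp add: L2_set_def)
  qed (simp_all add: L2_set_nonneg)
  finally show ?thesis by (simp add: mult_left_mono)
qed

section \<open>Telescoping the difference of two GGT matrices\<close>

lemma ggt_rho_power2: "cmod (\<alpha> n) \<le> 1 \<Longrightarrow> (ggt_rho \<alpha> n)\<^sup>2 = 1 - (cmod (\<alpha> n))\<^sup>2"
  by (simp add: ggt_rho_def power_le_one)

text \<open>A GGT matrix is the infinite product \<open>\<Theta>\<^sub>0 \<Theta>\<^sub>1 \<Theta>\<^sub>2 \<dots>\<close>, where \<open>\<Theta>\<^sub>n\<close> acts on the span of \<open>e\<^sub>n\<close> and
  \<open>e\<^sub>n\<^sub>+\<^sub>1\<close> by the unitary \<open>2 \<times> 2\<close> matrix with rows \<open>(cnj \<alpha>\<^sub>n, \<rho>\<^sub>n)\<close> and \<open>(\<rho>\<^sub>n, - \<alpha>\<^sub>n)\<close>, and as the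
  identity elsewhere. The next definition is the column \<open>\<Theta>\<^sub>0 \<dots> \<Theta>\<^sub>n\<^sub>-\<^sub>1 e\<^sub>n\<close> of an initial product, and
  the one after it is row \<open>n\<close> of the final product \<open>\<Theta>\<^sub>n \<Theta>\<^sub>n\<^sub>+\<^sub>1 \<dots>\<close>.\<close>

definition ggt_col :: "(nat \<Rightarrow> complex) \<Rightarrow> nat \<Rightarrow> nat \<Rightarrow> complex" where
  "ggt_col \<alpha> n k = (if k \<le> n then - ggt_prev \<alpha> k * of_real (\<Prod>m=k..<n. ggt_rho \<alpha> m) else 0)"

definition ggt_row :: "(nat \<Rightarrow> complex) \<Rightarrow> nat \<Rightarrow> nat \<Rightarrow> complex" where
  "ggt_row \<alpha> n l = (if n \<le> l then cnj (\<alpha> l) * of_real (\<Prod>m=n..<l. ggt_rho \<alpha> m) else 0)"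

lemma ggt_entry_col: "k \<le> l \<Longrightarrow> ggt_entry \<alpha> k l = cnj (\<alpha> l) * ggt_col \<alpha> l k"
  by (simp add: ggt_entry_def ggt_col_def)

lemma ggt_entry_row: "k \<le> l \<Longrightarrow> ggt_entry \<alpha> k l = - ggt_prev \<alpha> k * ggt_row \<alpha> k l"
  by (simp add: ggt_entry_def ggt_row_def)

lemma ggt_col_Suc:
  "ggt_col \<alpha> (Suc n) k =
    (if k \<le> n then of_real (ggt_rho \<alpha> n) * ggt_col \<alpha> n k else if k = Suc n then - \<alpha> n else 0)"
  by (auto simp: ggt_col_def ggt_prev_def)

lemma ggt_row_rec:
  "ggt_row \<alpha> n l = (if l = n then cnj (\<alpha> n) else of_real (ggt_rho \<alpha> n) * ggt_row \<alpha> (Suc n) l)"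
  using prod.atLeast_Suc_lessThan[of n l "ggt_rho \<alpha>"]
  by (cases l n rule: linorder_cases) (auto simp: ggt_row_def)

text \<open>The columns of the initial products are unit vectors because each \<open>\<Theta>\<^sub>n\<close> is unitary. In terms
  of entries: \<open>c\<^sub>n\<^sub>+\<^sub>1 = \<rho>\<^sub>n c\<^sub>n - \<alpha>\<^sub>n e\<^sub>n\<^sub>+\<^sub>1\<close>, where \<open>c\<^sub>n\<close> is orthogonal to \<open>e\<^sub>n\<^sub>+\<^sub>1\<close>.\<close>

lemma sum_ggt_col:
  assumes "\<And>n. cmod (\<alpha> n) \<le> 1"
  shows "(\<Sum>k<Suc n. (cmod (ggt_col \<alpha> n k))\<^sup>2) = 1"
proof (induction n)
  case (Suc n)
  have "(\<Sum>k<Suc n. (cmod (ggt_col \<alpha> (Suc n) k))\<^sup>2)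
      = (ggt_rho \<alpha> n)\<^sup>2 * (\<Sum>k<Suc n. (cmod (ggt_col \<alpha> n k))\<^sup>2)"
    unfolding sum_distrib_left
    by (rule sum.cong) (auto simp: ggt_col_Suc norm_mult power_mult_distrib)
  then show ?case
    unfolding Suc sum.lessThan_Suc[of _ "Suc n"] by (simp add: ggt_col_Suc ggt_rho_power2 assms)
qed (simp add: ggt_col_def ggt_prev_def)

text \<open>The sum telescopes: with \<open>p\<close> the product of the \<open>\<rho>\<^sub>m\<close> for \<open>n \<le> m < l\<close>, the squared entry at \<open>l\<close> is
  \<open>|\<alpha>\<^sub>l|\<^sup>2 p\<^sup>2 = p\<^sup>2 - (\<rho>\<^sub>l p)\<^sup>2\<close>. So the rows have norm at most \<open>1\<close>.\<close>

lemma sum_ggt_row: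
  assumes "\<And>n. cmod (\<alpha> n) \<le> 1"
  shows "(\<Sum>l<N. (cmod (ggt_row \<alpha> n l))\<^sup>2) = (if n \<le> N then 1 - (\<Prod>m=n..<N. ggt_rho \<alpha> m)\<^sup>2 else 0)"
proof (induction N)
  case (Suc N)
  consider "n \<le> N" | "n = Suc N" | "n > Suc N" by linarith
  then show ?case
    unfolding sum.lessThan_Suc Suc
    by cases (auto simp: ggt_row_def norm_mult power_mult_distrib ggt_rho_power2 assms algebra_simps
        simp flip: of_real_prod)
qed (auto simp: ggt_row_def)

text \<open>The matrix of \<open>\<Theta>\<^sub>0(\<alpha>) \<dots> \<Theta>\<^sub>N\<^sub>-\<^sub>1(\<alpha>) \<Theta>\<^sub>N(\<beta>) \<Theta>\<^sub>N\<^sub>+\<^sub>1(\<beta>) \<dots>\<close>. The factors with \<open>\<beta>\<close> fix \<open>e\<^sub>l\<close> for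
  \<open>l < N\<close>, and those with \<open>\<alpha>\<close> do not change the coordinates \<open>k > N\<close>. For \<open>l \<ge> N\<close> the \<open>\<beta>\<close>-product maps
  \<open>e\<^sub>l\<close> into the closed span of the \<open>e\<^sub>j\<close> with \<open>j \<ge> N\<close>, and of these the \<open>\<alpha>\<close>-product moves only \<open>e\<^sub>N\<close>;
  so the block with \<open>k \<le> N \<le> l\<close> has rank one.\<close>

definition ggt_hybrid ::
  "(nat \<Rightarrow> complex) \<Rightarrow> (nat \<Rightarrow> complex) \<Rightarrow> nat \<Rightarrow> nat \<Rightarrow> nat \<Rightarrow> complex" where
  "ggt_hybrid \<alpha> \<beta> N k l =
    (if l < N then ggt_entry \<alpha> k l
     else if k \<le> N then ggt_col \<alpha> N k * ggt_row \<beta> N l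
     else ggt_entry \<beta> k l)"

text \<open>Column \<open>l\<close> of \<open>\<Theta>\<^sub>0(\<alpha>) \<dots> \<Theta>\<^sub>n\<^sub>-\<^sub>1(\<alpha>) (\<Theta>\<^sub>n(\<alpha>) - \<Theta>\<^sub>n(\<beta>)) \<Theta>\<^sub>n\<^sub>+\<^sub>1(\<beta>) \<dots>\<close>. The four terms are the
  four entries of the difference of the \<open>2 \<times> 2\<close> blocks; its column vectors at \<open>e\<^sub>n\<close> and \<open>e\<^sub>n\<^sub>+\<^sub>1\<close>
  become \<open>u\<close> and \<open>e\<^sub>n\<^sub>+\<^sub>1\<close> under the factors on the left, and its row vectors become \<open>e\<^sub>n\<close> and row
  \<open>n + 1\<close> of the final product under those on the right.\<close>

definition ggt_step :: "(nat \<Rightarrow> complex) \<Rightarrow> (nat \<Rightarrow> complex) \<Rightarrow> nat \<Rightarrow> nat \<Rightarrow> ell2" where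
  "ggt_step \<alpha> \<beta> n l =
    (let a = \<alpha> n - \<beta> n; s = complex_of_real (ggt_rho \<alpha> n - ggt_rho \<beta> n);
         u = ell2_truncate (Suc n) (ggt_col \<alpha> n); d = (if l = n then 1 else 0)
     in scaleC (cnj a * d) u + scaleC (s * ggt_row \<beta> (Suc n) l) u
        + scaleC (s * d) (ell2_basis (Suc n))
        + scaleC (- a * ggt_row \<beta> (Suc n) l) (ell2_basis (Suc n)))"

lemma ggt_hybrid_step:
  "ggt_hybrid \<alpha> \<beta> (Suc n) k l - ggt_hybrid \<alpha> \<beta> n k l = ell2_nth (ggt_step \<alpha> \<beta> n l) k"
proof -
  consider "l < n" | "l = n" | "n < l" by linarith
  then show ?thesis
  proof cases
    case 1
    then show ?thesis
      by (auto simp: ggt_hybrid_def ggt_step_def Let_def ell2_nth_simps ell2_nth_truncate ggt_row_def)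
  next
    case 2
    then show ?thesis
      by (auto simp: ggt_hybrid_def ggt_step_def Let_def ell2_nth_simps ell2_nth_truncate
          ggt_row_rec[of \<beta> n n] ggt_entry_col algebra_simps)
        (auto simp: ggt_entry_def ggt_row_def)
  next
    case 3
    consider "k \<le> n" | "k = Suc n" | "Suc n < k" by linarith
    then show ?thesis
      using 3
      by cases (auto simp: ggt_hybrid_def ggt_step_def Let_def ell2_nth_simps ell2_nth_truncate
          ggt_row_rec[of \<beta> n l] ggt_col_Suc ggt_entry_row ggt_prev_def algebra_simps)
  qed
qed

text \<open>Column \<open>l\<close> is not affected by the steps with \<open>n > l\<close>, so on a basis vector the telescoping sum is
  finite and no convergence has to be discussed.\<close>

lemma ggt_diff_telescope:
  assumes "\<And>n. cmod (\<alpha> n) \<le> 1" "\<And>n. cmod (\<beta> n) \<le> 1" "l < N"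
  shows "GGT \<alpha> (ell2_basis l) - GGT \<beta> (ell2_basis l) = (\<Sum>n<N. ggt_step \<alpha> \<beta> n l)"
proof (rule ell2_eqI)
  fix k
  have "ell2_nth (\<Sum>n<N. ggt_step \<alpha> \<beta> n l) k = ggt_hybrid \<alpha> \<beta> N k l - ggt_hybrid \<alpha> \<beta> 0 k l"
    unfolding ell2_nth_sum ggt_hybrid_step[symmetric] by (rule sum_lessThan_telescope)
  also have "\<dots> = ggt_entry \<alpha> k l - ggt_entry \<beta> k l"
    using assms(3) by (simp add: ggt_hybrid_def ggt_col_def ggt_prev_def ggt_entry_row)
  finally show "ell2_nth (GGT \<alpha> (ell2_basis l) - GGT \<beta> (ell2_basis l)) k
      = ell2_nth (\<Sum>n<N. ggt_step \<alpha> \<beta> n l) k"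
    using GGT_matrix_elements[of \<alpha> k l] GGT_matrix_elements[of \<beta> k l] assms(1,2)
    by (simp add: cinner_ell2_basis minus_ell2.rep_eq)
qed

text \<open>Each of the four terms of a step is a rank one matrix with factors of norm at most \<open>1\<close>, scaled
  by \<open>\<plusminus> (\<alpha>\<^sub>n - \<beta>\<^sub>n)\<close>, its conjugate, or \<open>\<rho>\<^sub>n - \<sigma>\<^sub>n\<close>. The two diagonal and the two off-diagonal entries
  account for the factor \<open>2\<close>.\<close>

lemma ggt_step_trace_bound:
  assumes disk: "\<And>n. cmod (\<alpha> n) \<le> 1" "\<And>n. cmod (\<beta> n) \<le> 1"
    and W: "bounded_op W" "\<And>x. norm (W x) \<le> norm x"
  shows "(\<Sum>l<N. inner (ell2_basis l) (W (ggt_step \<alpha> \<beta> n l)))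
    \<le> 2 * (cmod (\<alpha> n - \<beta> n) + \<bar>ggt_rho \<beta> n - ggt_rho \<alpha> n\<bar>)"
proof -
  define a s u where "a = \<alpha> n - \<beta> n" and "s = complex_of_real (ggt_rho \<alpha> n - ggt_rho \<beta> n)"
    and "u = ell2_truncate (Suc n) (ggt_col \<alpha> n)"
  define d where "d l = (if l = n then 1 else 0 :: complex)" for l
  define r where "r = ggt_row \<beta> (Suc n)"
  define S where "S c v w = (\<Sum>l<N. inner (ell2_basis l) (W (scaleC (c * v l) w)))" for c v w
  interpret W: bounded_linear W by (rule bounded_op_bounded_linear[OF W(1)])
  have "(\<Sum>l<N. inner (ell2_basis l) (W (ggt_step \<alpha> \<beta> n l)))
      = S (cnj a) d u + S s r u + S s d (ell2_basis (Suc n)) + S (- a) r (ell2_basis (Suc n))"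
    unfolding ggt_step_def Let_def W.add inner_add_right sum.distrib S_def a_def s_def u_def
        d_def r_def ..
  also have "\<dots> \<le> cmod (cnj a) + cmod s + cmod s + cmod (- a)"
  proof -
    have "(norm u)\<^sup>2 = 1"
      unfolding u_def norm_truncate by (rule sum_ggt_col[OF disk(1)])
    then have u: "norm u \<le> 1" using power2_le_imp_le[of "norm u" 1] by simp
    have d: "(\<Sum>l<N. (cmod (d l))\<^sup>2) \<le> 1"
      by (simp add: d_def if_distrib[of cmod] if_distrib[of "\<lambda>x. x\<^sup>2"] cong: if_cong)
    have r: "(\<Sum>l<N. (cmod (r l))\<^sup>2) \<le> 1"
      by (simp add: r_def sum_ggt_row[OF disk(2)])
    show ?thesis
      unfolding S_def by (intro add_mono rank_one_trace_bound W u d r) (simp_all add: norm_ell2_basis)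
  qed
  also have "\<dots> = 2 * (cmod (\<alpha> n - \<beta> n) + \<bar>ggt_rho \<beta> n - ggt_rho \<alpha> n\<bar>)"
    by (simp add: s_def abs_minus_commute del: of_real_diff flip: a_def)
  finally show ?thesis .
qed

theorem theorem10p4:
  fixes \<alpha> \<beta> :: "nat \<Rightarrow> complex"
  assumes "\<And>n. cmod (\<alpha> n) \<le> 1" and "\<And>n. cmod (\<beta> n) \<le> 1"
  shows "trace_norm (\<lambda>x. GGT \<alpha> x - GGT \<beta> x)
           \<le> 2 * (\<Sum>n. ennreal (cmod (\<alpha> n - \<beta> n) + \<bar>ggt_rho \<beta> n - ggt_rho \<alpha> n\<bar>))
       \<and> ((\<Sum>n. ennreal (cmod (\<alpha> n - \<beta> n) + \<bar>ggt_rho \<beta> n - ggt_rho \<alpha> n\<bar>)) < \<infinity>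
           \<longrightarrow> trace_class (\<lambda>x. GGT \<alpha> x - GGT \<beta> x))"
proof -
  define D where "D x = GGT \<alpha> x - GGT \<beta> x" for x
  define f where "f n = cmod (\<alpha> n - \<beta> n) + \<bar>ggt_rho \<beta> n - ggt_rho \<alpha> n\<bar>" for n
  have f: "0 \<le> f n" for n by (simp add: f_def)
  have D: "bounded_op D"
    unfolding D_def by (intro bounded_op_diff bounded_op_GGT assms)
  have "trace_norm D \<le> 2 * (\<Sum>n. ennreal (f n))"
  proof (rule trace_norm_le[OF D])
    fix W N assume W: "bounded_op W" "\<And>x. norm (W x) \<le> norm x"
    interpret W: bounded_linear W by (rule bounded_op_bounded_linear[OF W(1)])
    have "(\<Sum>l<N. inner (ell2_basis l) (W (D (ell2_basis l))))
        = (\<Sum>l<N. \<Sum>n<N. inner (ell2_basis l) (W (ggt_step \<alpha> \<beta> n l)))"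
      by (rule sum.cong) (simp_all add: D_def ggt_diff_telescope[OF assms, of _ N] W.sum inner_sum_right)
    also have "\<dots> = (\<Sum>n<N. \<Sum>l<N. inner (ell2_basis l) (W (ggt_step \<alpha> \<beta> n l)))"
      by (rule sum.swap)
    also have "\<dots> \<le> (\<Sum>n<N. 2 * f n)"
      unfolding f_def by (intro sum_mono ggt_step_trace_bound assms W)
    finally have "ennreal (\<Sum>l<N. inner (ell2_basis l) (W (D (ell2_basis l))))
        \<le> ennreal (2 * (\<Sum>n<N. f n))"
      by (simp add: ennreal_leI sum_distrib_left)
    also have "\<dots> = 2 * (\<Sum>n<N. ennreal (f n))"
      using f by (simp add: ennreal_mult sum_nonneg sum_ennreal)
    also have "\<dots> \<le> 2 * (\<Sum>n. ennreal (f n))"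
      by (intro mult_left_mono sum_le_suminf) auto
    finally show "ennreal (\<Sum>l<N. inner (ell2_basis l) (W (D (ell2_basis l))))
        \<le> 2 * (\<Sum>n. ennreal (f n))" .
  qed
  moreover from this have "trace_class D" if "(\<Sum>n. ennreal (f n)) < \<infinity>"
    using that D by (auto simp: trace_class_def ennreal_mult_less_top intro: order.strict_trans1)
  ultimately show ?thesis unfolding D_def f_def by blast
qed

end
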